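(* Let $n>1$, let $\Omega\subset\mathbb{R}^n$ be an open, bounded and connected domain, let $\boldsymbol{x}'\in\Omega$, and for $\Delta x>0$ consider a hypercube-shaped cell with centre $\boldsymbol{x}'$ and side length $\Delta x$ contained in $\Omega$. For $\varepsilon>0$ let $\boldsymbol{f}_t$ and $\boldsymbol{f}_\varepsilon$ be the point force distribution and its Gaussian-smoothed version defined in the context. Let $\boldsymbol{u}_h\in\boldsymbol{V}_h(\Omega)$ be the Galerkin solution to $$a(\boldsymbol{u}_h,\boldsymbol{\phi}_h)=\int_\Omega\boldsymbol{f}_t\cdot\boldsymbol{\phi}_h\,d\Omega\quad\text{for all }\boldsymbol{\phi}_h\in\boldsymbol{V}_h(\Omega),$$ and let $\boldsymbol{u}^\varepsilon_h\in\boldsymbol{V}_h(\Omega)$ be the Galerkin solution to $$a(\boldsymbol{u}^\varepsilon_h,\boldsymbol{\phi}_h)=\int_\Omega\boldsymbol{f}_\varepsilon\cdot\boldsymbol{\phi}_h\,d\Omega\quad\text{for all }\boldsymbol{\phi}_h\in\boldsymbol{V}_h(\Omega).$$ Then there is an $L_1>0$, independent of $\Delta x$ and $\varepsilon$, such that $$\|\boldsymbol{u}^\varepsilon_h-\boldsymbol{u}_h\|_{\boldsymbol{H}^1(\Omega)}\leqslant L_1\,(\Delta x)^{(n-1)/2}\,\varepsilon.$$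
   Context: Bold function spaces denote spaces of $\mathbb{R}^n$-valued functions. For a displacement field $\boldsymbol{u}$, $\boldsymbol{\epsilon}(\boldsymbol{u})=\frac12[\nabla\boldsymbol{u}+(\nabla\boldsymbol{u})^T]$, $$\boldsymbol{\sigma}(\boldsymbol{u})=\frac{E}{1+\nu}\Big\{\boldsymbol{\epsilon}(\boldsymbol{u})+\mathrm{tr}(\boldsymbol{\epsilon}(\boldsymbol{u}))\,\frac{\nu}{1-2\nu}\,\boldsymbol{I}\Big\},$$ with constant $E>0$, $0\le\nu<1/2$, and $a(\boldsymbol{u},\boldsymbol{v})=\int_\Omega\boldsymbol{\sigma}(\boldsymbol{u}):\boldsymbol{\epsilon}(\boldsymbol{v})\,d\Omega$. $\boldsymbol{V}_h(\Omega)\subset\boldsymbol{H}^1_0(\Omega)$ is a fixed finite-dimensional space spanned by continuous, piecewise linear Lagrangian basis field functions on a fixed finite mesh, vanishing on $\partial\Omega$. Let $P$ be a constant (force magnitude), $\boldsymbol{e}_i$ the $i$-th standard basis vector, $\delta$ the Dirac delta distribution, and $$\delta_\varepsilon(\boldsymbol{x})=\frac{1}{(2\pi\varepsilon^2)^{n/2}}\exp\Big\{-\frac{\|\boldsymbol{x}\|^2}{2\varepsilon^2}\Big\}.$$ The forces, exerted at the midpoints of the faces of the hypercube and directed along the inward normals, are $$\boldsymbol{f}_t(\boldsymbol{x})=P(\Delta x)^{n-1}\sum_{i=1}^n\boldsymbol{e}_i\Big[\delta\big(\boldsymbol{x}-\boldsymbol{x}'+\tfrac{\Delta x}{2}\boldsymbol{e}_i\big)-\delta\big(\boldsymbol{x}-\boldsymbol{x}'-\tfrac{\Delta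 x}{2}\boldsymbol{e}_i\big)\Big],$$ $$\boldsymbol{f}_\varepsilon(\boldsymbol{x})=P(\Delta x)^{n-1}\sum_{i=1}^n\boldsymbol{e}_i\Big[\delta_\varepsilon\big(\boldsymbol{x}-\boldsymbol{x}'+\tfrac{\Delta x}{2}\boldsymbol{e}_i\big)-\delta_\varepsilon\big(\boldsymbol{x}-\boldsymbol{x}'-\tfrac{\Delta x}{2}\boldsymbol{e}_i\big)\Big].$$ The integral $\int_\Omega\boldsymbol{f}_t\cdot\boldsymbol{\phi}_h\,d\Omega$ denotes the action of the delta distributions, i.e. $P(\Delta x)^{n-1}\sum_{i}\boldsymbol{e}_i\cdot[\boldsymbol{\phi}_h(\boldsymbol{x}'-\frac{\Delta x}{2}\boldsymbol{e}_i)-\boldsymbol{\phi}_h(\boldsymbol{x}'+\frac{\Delta x}{2}\boldsymbol{e}_i)]$. *)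

theory Defs
  imports "HOL-Analysis.Analysis"
begin

section \<open>Sobolev space $H^1$ of vector fields\<close>

definition square_integrable_field :: "(real^'n) set \<Rightarrow> (real^'n \<Rightarrow> 'b::euclidean_space) \<Rightarrow> bool" where
  "square_integrable_field \<Omega> f \<longleftrightarrow>
     f \<in> borel_measurable (lebesgue_on \<Omega>) \<and> integrable (lebesgue_on \<Omega>) (\<lambda>x. (norm (f x))\<^sup>2)"

text \<open>\<open>\<phi>\<close> is a $C^1$ function with compact support in \<open>\<Omega>\<close> and gradient \<open>\<phi>'\<close>. Testing weak
  first derivatives against $C^1_c$ is the convention of Gilbarg and Trudinger.\<close>

definition test_function ::
    "(real^'n) set \<Rightarrow> (real^'n \<Rightarrow> real) \<Rightarrow> (real^'n \<Rightarrow> real^'n) \<Rightarrow> bool" where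
  "test_function \<Omega> \<phi> \<phi>' \<longleftrightarrow>
     (\<forall>x. GDERIV \<phi> x :> \<phi>' x) \<and> continuous_on UNIV \<phi>' \<and>
     (\<exists>K. compact K \<and> K \<subseteq> \<Omega> \<and> (\<forall>x. x \<notin> K \<longrightarrow> \<phi> x = 0))"

text \<open>Both the field and its weak gradient are in $L^2(\Omega)$; the entry \<open>G x $ i $ j\<close> is the weak
  partial derivative of the \<open>i\<close>-th component in direction \<open>j\<close>.\<close>

definition has_weak_gradient ::
    "(real^'n) set \<Rightarrow> (real^'n \<Rightarrow> real^'n) \<Rightarrow> (real^'n \<Rightarrow> real^'n^'n) \<Rightarrow> bool" where
  "has_weak_gradient \<Omega> u G \<longleftrightarrow>
     square_integrable_field \<Omega> u \<and> square_integrable_field \<Omega> G \<and>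
     (\<forall>\<phi> \<phi>'. test_function \<Omega> \<phi> \<phi>' \<longrightarrow>
        (\<forall>i j. (LINT x|lebesgue_on \<Omega>. u x $ i * \<phi>' x $ j)
              = - (LINT x|lebesgue_on \<Omega>. G x $ i $ j * \<phi> x)))"

text \<open>Weak gradients are unique only up to null sets; the chosen representative is used
  under integrals over \<open>\<Omega>\<close> only.\<close>

definition weak_gradient :: "(real^'n) set \<Rightarrow> (real^'n \<Rightarrow> real^'n) \<Rightarrow> real^'n \<Rightarrow> real^'n^'n" where
  "weak_gradient \<Omega> u = (SOME G. has_weak_gradient \<Omega> u G)"

text \<open>The norm on \<^typ>\<open>real^'n^'n\<close> is the Frobenius norm, and its inner product is the double
  contraction $A : B$.\<close>

definition H1_norm :: "(real^'n) set \<Rightarrow> (real^'n \<Rightarrow> real^'n) \<Rightarrow> real" where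
  "H1_norm \<Omega> u =
     sqrt ((LINT x|lebesgue_on \<Omega>. (norm (u x))\<^sup>2)
         + (LINT x|lebesgue_on \<Omega>. (norm (weak_gradient \<Omega> u x))\<^sup>2))"


section \<open>Linear elasticity\<close>

definition strain :: "(real^'n) set \<Rightarrow> (real^'n \<Rightarrow> real^'n) \<Rightarrow> real^'n \<Rightarrow> real^'n^'n" where
  "strain \<Omega> u x = (1/2) *\<^sub>R (weak_gradient \<Omega> u x + transpose (weak_gradient \<Omega> u x))"

definition stress ::
    "real \<Rightarrow> real \<Rightarrow> (real^'n) set \<Rightarrow> (real^'n \<Rightarrow> real^'n) \<Rightarrow> real^'n \<Rightarrow> real^'n^'n" where
  "stress E \<nu> \<Omega> u x =
     (E / (1 + \<nu>)) *\<^sub>R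
       (strain \<Omega> u x + (trace (strain \<Omega> u x) * (\<nu> / (1 - 2 * \<nu>))) *\<^sub>R mat 1)"

definition elastic_form ::
    "real \<Rightarrow> real \<Rightarrow> (real^'n) set \<Rightarrow> (real^'n \<Rightarrow> real^'n) \<Rightarrow> (real^'n \<Rightarrow> real^'n) \<Rightarrow> real" where
  "elastic_form E \<nu> \<Omega> u v = (LINT x|lebesgue_on \<Omega>. stress E \<nu> \<Omega> u x \<bullet> strain \<Omega> v x)"


section \<open>Piecewise linear Lagrange finite elements\<close>

text \<open>A finite conforming mesh of non-degenerate \<open>n\<close>-simplices. The simplices need not fill
  \<open>closure \<Omega>\<close>, since \<open>\<Omega>\<close> is not assumed to be polyhedral.\<close>

definition mesh_of :: "(real^'n) set \<Rightarrow> (real^'n) set set \<Rightarrow> bool" where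
  "mesh_of \<Omega> \<T> \<longleftrightarrow>
     triangulation \<T> \<and> (\<forall>S\<in>\<T>. int CARD('n) simplex S) \<and> \<Union>\<T> \<subseteq> closure \<Omega>"

definition mesh_nodes :: "(real^'n) set set \<Rightarrow> (real^'n) set" where
  "mesh_nodes \<T> = {p. \<exists>S\<in>\<T>. p extreme_point_of S}"

text \<open>The nodal (hat) function of the node \<open>p\<close>, extended by zero outside the mesh.\<close>

definition lagrange_function ::
    "(real^'n) set \<Rightarrow> (real^'n) set set \<Rightarrow> real^'n \<Rightarrow> (real^'n \<Rightarrow> real) \<Rightarrow> bool" where
  "lagrange_function \<Omega> \<T> p \<psi> \<longleftrightarrow>
     continuous_on (closure \<Omega>) \<psi> \<and>
     (\<forall>S\<in>\<T>. \<exists>a b. \<forall>x\<in>S. \<psi> x = a \<bullet> x + b) \<and>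
     (\<forall>q\<in>mesh_nodes \<T>. \<psi> q = (if q = p then 1 else 0)) \<and>
     (\<forall>x. x \<notin> \<Union>\<T> \<longrightarrow> \<psi> x = 0)"

definition fe_basis :: "(real^'n) set \<Rightarrow> (real^'n) set set \<Rightarrow> (real^'n \<Rightarrow> real^'n) set" where
  "fe_basis \<Omega> \<T> =
     {(\<lambda>x. \<psi> x *\<^sub>R axis i 1) | \<psi> i p.
        p \<in> mesh_nodes \<T> \<and> lagrange_function \<Omega> \<T> p \<psi> \<and> (\<forall>x\<in>frontier \<Omega>. \<psi> x = 0)}"

text \<open>The linear span of the basis fields, written out because function types are no instance of
  \<^class>\<open>real_vector\<close>. Its elements are continuous on \<open>closure \<Omega>\<close>, piecewise affine, and zero on the
  boundary, so they belong to $H^1_0(\Omega)$.\<close>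

definition fe_space :: "(real^'n) set \<Rightarrow> (real^'n) set set \<Rightarrow> (real^'n \<Rightarrow> real^'n) set" where
  "fe_space \<Omega> \<T> =
     {(\<lambda>x. \<Sum>b\<in>B. c b *\<^sub>R b x) | B c. finite B \<and> B \<subseteq> fe_basis \<Omega> \<T>}"

definition galerkin_solution ::
    "((real^'n \<Rightarrow> real^'n) \<Rightarrow> (real^'n \<Rightarrow> real^'n) \<Rightarrow> real) \<Rightarrow> (real^'n \<Rightarrow> real^'n) set
     \<Rightarrow> ((real^'n \<Rightarrow> real^'n) \<Rightarrow> real) \<Rightarrow> (real^'n \<Rightarrow> real^'n) \<Rightarrow> bool" where
  "galerkin_solution a V F u \<longleftrightarrow> u \<in> V \<and> (\<forall>\<phi>\<in>V. a u \<phi> = F \<phi>)"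


section \<open>Forces on the faces of a cell\<close>

definition cell :: "real^'n \<Rightarrow> real \<Rightarrow> (real^'n) set" where
  "cell x' \<Delta>x = cbox (x' - vec (\<Delta>x / 2)) (x' + vec (\<Delta>x / 2))"

definition gaussian :: "real \<Rightarrow> real^'n \<Rightarrow> real" where
  "gaussian \<epsilon> x =
     1 / ((2 * pi * \<epsilon>\<^sup>2) powr (real CARD('n) / 2)) * exp (- ((norm x)\<^sup>2 / (2 * \<epsilon>\<^sup>2)))"

definition smoothed_force :: "real \<Rightarrow> real^'n \<Rightarrow> real \<Rightarrow> real \<Rightarrow> real^'n \<Rightarrow> real^'n" where
  "smoothed_force P x' \<Delta>x \<epsilon> x =
     (P * \<Delta>x ^ (CARD('n) - 1)) *\<^sub>R
       (\<Sum>i\<in>UNIV. (gaussian \<epsilon> (x - x' + (\<Delta>x / 2) *\<^sub>R axis i 1)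
                  - gaussian \<epsilon> (x - x' - (\<Delta>x / 2) *\<^sub>R axis i 1)) *\<^sub>R axis i 1)"

definition smoothed_load ::
    "(real^'n) set \<Rightarrow> real \<Rightarrow> real^'n \<Rightarrow> real \<Rightarrow> real \<Rightarrow> (real^'n \<Rightarrow> real^'n) \<Rightarrow> real" where
  "smoothed_load \<Omega> P x' \<Delta>x \<epsilon> \<phi> =
     (LINT x|lebesgue_on \<Omega>. smoothed_force P x' \<Delta>x \<epsilon> x \<bullet> \<phi> x)"

text \<open>The action of the sum of Dirac distributions on a continuous field.\<close>

definition point_load :: "real \<Rightarrow> real^'n \<Rightarrow> real \<Rightarrow> (real^'n \<Rightarrow> real^'n) \<Rightarrow> real" where
  "point_load P x' \<Delta>x \<phi> =
     P * \<Delta>x ^ (CARD('n) - 1) *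
       (\<Sum>i\<in>UNIV. axis i 1 \<bullet> (\<phi> (x' - (\<Delta>x / 2) *\<^sub>R axis i 1) - \<phi> (x' + (\<Delta>x / 2) *\<^sub>R axis i 1)))"

end

theory Submission
  imports Defs "HOL-Probability.Distributions"
begin

text \<open>Let \<open>w = u\<epsilon>\<^sub>h - u\<^sub>h\<close>. It belongs to the finite element space, so it is an admissible test field
  in both Galerkin equations, and subtracting them gives
  \<open>a(w, w) = smoothed_load w - point_load w\<close>. The proof bounds both sides by powers of
  \<open>A\<close>, the $L^2(\Omega)$ norm of the gradient of \<open>w\<close>.

  The left side is at least a positive multiple of \<open>A\<^sup>2\<close> (\<open>elastic_form_coercive\<close>), by Korn's
  first inequality for fields that vanish outside \<open>\<Omega>\<close>. Korn's inequality follows from the identity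
  \<open>\<integral> (\<partial>\<^sub>j w\<^sub>i) (\<partial>\<^sub>i w\<^sub>j) = \<integral> (\<partial>\<^sub>i w\<^sub>i) (\<partial>\<^sub>j w\<^sub>j)\<close>, which for Lipschitz functions of bounded support is the limit of
  the same identity for difference quotients, where it is summation by parts
  (\<open>integral_gradient_swap\<close>).

  For the right side, \<open>w\<close> is continuous, piecewise affine and zero outside \<open>\<Omega>\<close>, hence globally
  Lipschitz. On a simplex its gradient is constant, so on a fixed mesh the Lipschitz constant is at most
  \<open>C A\<close> (\<open>inverse_estimate\<close>). The smoothed load can be integrated over the whole space because \<open>w\<close>
  vanishes outside \<open>\<Omega>\<close>, and the average of a Lipschitz function against a Gaussian of width \<open>\<epsilon>\<close> differs
  from its value at the centre by at most a constant times \<open>\<epsilon>\<close> times the Lipschitz constant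
  (\<open>gaussian_smoothing_error\<close>). The right side is therefore at most a constant times
  \<open>\<Delta>x ^ (n - 1) * \<epsilon> * A\<close>.

  Together these give \<open>A \<le> D * \<Delta>x ^ (n - 1) * \<epsilon>\<close>. The $L^2$ norm of \<open>w\<close> itself is controlled by its
  Lipschitz constant (\<open>L2_le_lipschitz\<close>), and since the cell lies in the bounded set \<open>\<Omega>\<close>, half of the
  power of \<open>\<Delta>x\<close> is bounded by a constant.

  All of this concerns the classical gradient, which exists almost everywhere. It is the weak gradient by
  integration by parts (\<open>integral_gradient_by_parts\<close>, again a limit of difference quotients), and weak
  gradients are unique almost everywhere by the fundamental lemma of the calculus of variations
  (\<open>AE_eq_0_if_orthogonal\<close>), so the gradient selected in the norm and the bilinear form agrees with it.\<close>

section \<open>The fundamental lemma of the calculus of variations\<close>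

lemma lebesgue_measurable_continuous:
  fixes f :: "'a::euclidean_space \<Rightarrow> 'b::euclidean_space"
  assumes "continuous_on UNIV f"
  shows "f \<in> borel_measurable lebesgue"
  using borel_measurable_continuous_onI[OF assms] by (simp add: measurable_completion)

lemma one_plus_power2_pos: "0 < 1 + (s::real)\<^sup>2"
  by (rule add_pos_nonneg) auto

lemma DERIV_max_power2: "DERIV (\<lambda>s. (max 0 s)\<^sup>2) s :> 2 * max 0 (s::real)"
proof -
  consider "s < 0" | "s > 0" | "s = 0" by linarith
  then show ?thesis
  proof cases
    case 1
    have "\<forall>\<^sub>F t in nhds s. (max 0 t)\<^sup>2 = 0"
      using eventually_nhds_in_open[of "{..<0}" s] 1 by (auto elim!: eventually_mono)
    then have "DERIV (\<lambda>s. (max 0 s)\<^sup>2) s :> 0 \<longleftrightarrow> DERIV (\<lambda>s. 0) s :> 0"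
      by (intro DERIV_cong_ev) auto
    then have "DERIV (\<lambda>s. (max 0 s)\<^sup>2) s :> 0" by simp
    then show ?thesis using 1 by simp
  next
    case 2
    have "\<forall>\<^sub>F t in nhds s. (max 0 t)\<^sup>2 = t\<^sup>2"
      using eventually_nhds_in_open[of "{0<..}" s] 2 by (auto elim!: eventually_mono)
    then have "DERIV (\<lambda>s. (max 0 s)\<^sup>2) s :> 2 * s \<longleftrightarrow> DERIV (\<lambda>s. s\<^sup>2) s :> 2 * s"
      by (intro DERIV_cong_ev) auto
    moreover have "DERIV (\<lambda>s. s\<^sup>2) s :> 2 * s" by (auto intro!: derivative_eq_intros)
    ultimately have "DERIV (\<lambda>s. (max 0 s)\<^sup>2) s :> 2 * s" by simp
    then show ?thesis using 2 by simp
  next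
    case 3
    have "((\<lambda>h. ((max 0 (0 + h))\<^sup>2 - (max 0 0)\<^sup>2) / h) \<longlongrightarrow> 0) (at (0::real))"
    proof (rule Lim_null_comparison)
      show "\<forall>\<^sub>F h in at 0. norm (((max 0 (0 + h))\<^sup>2 - (max 0 0)\<^sup>2) / h) \<le> \<bar>h::real\<bar>"
        by (auto intro!: always_eventually simp: max_def power2_eq_square abs_mult)
      show "((\<lambda>h::real. \<bar>h\<bar>) \<longlongrightarrow> 0) (at 0)"
        by (rule tendsto_eq_intros refl | simp)+
    qed
    then show ?thesis using 3 by (simp add: DERIV_def)
  qed
qed

text \<open>A $C^1$ function with values in \<open>[0, 1)\<close> that is positive exactly on the ball (for \<open>0 < r\<close> and
  \<open>0 < t\<close>). As \<open>t\<close> tends to infinity it increases to the indicator function of the open ball.\<close>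

definition ball_bump :: "real^'n \<Rightarrow> real \<Rightarrow> real \<Rightarrow> real^'n \<Rightarrow> real" where
  "ball_bump c r t x =
     1 - 1 / (1 + (max 0 (t * (r\<^sup>2 - (x - c) \<bullet> (x - c))))\<^sup>2)"

lemma ball_bump_eq_0:
  assumes "x \<notin> ball c r" "0 < r" "0 \<le> t"
  shows "ball_bump c r t x = 0"
proof -
  have "r\<^sup>2 \<le> (x - c) \<bullet> (x - c)"
    using assms by (simp add: dot_square_norm dist_norm norm_minus_commute power_mono)
  then have "t * (r\<^sup>2 - (x - c) \<bullet> (x - c)) \<le> 0"
    using assms by (simp add: mult_nonneg_nonpos)
  then have "max 0 (t * (r\<^sup>2 - (x - c) \<bullet> (x - c))) = 0" by linarith
  then show ?thesis by (simp add: ball_bump_def)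
qed

lemma abs_ball_bump_le_1: "\<bar>ball_bump c r t x\<bar> \<le> 1"
proof -
  have "1 \<le> 1 + (max 0 (t * (r\<^sup>2 - (x - c) \<bullet> (x - c))))\<^sup>2" by simp
  then have "1 / (1 + (max 0 (t * (r\<^sup>2 - (x - c) \<bullet> (x - c))))\<^sup>2) \<le> 1"
    "0 \<le> 1 / (1 + (max 0 (t * (r\<^sup>2 - (x - c) \<bullet> (x - c))))\<^sup>2)"
    by (smt (verit) divide_le_eq_1 divide_nonneg_nonneg)+
  then show ?thesis unfolding ball_bump_def by linarith
qed

lemma ball_bump_tendsto:
  assumes "0 < r"
  shows "(\<lambda>k. ball_bump c r (real k) x) \<longlonglongrightarrow> indicator (ball c r) x"
proof (cases "x \<in> ball c r")
  case False
  then show ?thesis using assms by (simp add: ball_bump_eq_0)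
next
  case True
  define m where "m = r\<^sup>2 - (x - c) \<bullet> (x - c)"
  have "m > 0"
    using True by (simp add: m_def dot_square_norm dist_norm norm_minus_commute power_strict_mono)
  have "(\<lambda>k. 1 - 1 / (1 + (real k * m)\<^sup>2)) \<longlonglongrightarrow> 1 - 0"
  proof (intro tendsto_intros tendsto_divide_0 filterlim_at_top_imp_at_infinity)
    have "filterlim (\<lambda>k. real k * m) at_top sequentially"
      by (rule filterlim_at_top_mult_tendsto_pos[OF tendsto_const \<open>m > 0\<close> filterlim_real_sequentially])
    then have "filterlim (\<lambda>k. (real k * m)\<^sup>2) at_top sequentially"
      by (intro filterlim_pow_at_top) auto
    then show "filterlim (\<lambda>k. 1 + (real k * m)\<^sup>2) at_top sequentially"
      by (intro filterlim_tendsto_add_at_top[OF tendsto_const])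
  qed auto
  moreover have "max 0 (real k * m) = real k * m" for k using \<open>m > 0\<close> by (simp add: max_def)
  ultimately show ?thesis
    using True by (simp add: ball_bump_def flip: m_def)
qed

lemma GDERIV_ball_bump:
  fixes c x :: "real^'n" and r t :: real
  defines "m \<equiv> \<lambda>x. max 0 (t * (r\<^sup>2 - (x - c) \<bullet> (x - c)))"
  shows "GDERIV (ball_bump c r t) x :> (2 * m x / (1 + (m x)\<^sup>2)\<^sup>2 * (t * (-2))) *\<^sub>R (x - c)"
proof -
  have inner: "GDERIV (\<lambda>x. t * (r\<^sup>2 - (x - c) \<bullet> (x - c))) x :> (t * (-2)) *\<^sub>R (x - c)"
    unfolding gderiv_def
    by (rule has_derivative_eq_rhs, (rule derivative_intros)+)
      (simp add: fun_eq_iff inner_commute)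
  have outer: "DERIV (\<lambda>s. 1 - 1 / (1 + (max 0 s)\<^sup>2)) s :> 2 * max 0 s / (1 + (max 0 s)\<^sup>2)\<^sup>2" for s :: real
  proof -
    have "DERIV (\<lambda>s. 1 + (max 0 s)\<^sup>2) s :> 0 + 2 * max 0 s"
      by (intro DERIV_add DERIV_const DERIV_max_power2)
    note der = this
    have "1 + (max 0 s)\<^sup>2 \<noteq> 0"
      using one_plus_power2_pos[of "max 0 s"] by linarith
    then show ?thesis
      using DERIV_diff[OF DERIV_const[of 1] DERIV_inverse'[OF der]]
      by (simp add: divide_inverse power2_eq_square mult_ac)
  qed
  show ?thesis
    using GDERIV_DERIV_compose[OF inner outer] unfolding ball_bump_def[abs_def] m_def scaleR_scaleR .
qed

lemma continuous_on_ball_bump: "continuous_on UNIV (ball_bump c r t)"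
  by (intro continuous_at_imp_continuous_on ballI
      has_derivative_continuous[OF GDERIV_ball_bump[unfolded gderiv_def]])

lemma test_function_ball_bump:
  fixes c :: "real^'n"
  assumes "0 < r" "0 \<le> t" "cball c r \<subseteq> \<Omega>"
  shows "\<exists>\<phi>'. test_function \<Omega> (ball_bump c r t) \<phi>'"
proof -
  define m where "m = (\<lambda>x::real^'n. max 0 (t * (r\<^sup>2 - (x - c) \<bullet> (x - c))))"
  define \<phi>' where "\<phi>' = (\<lambda>x. (2 * m x / (1 + (m x)\<^sup>2)\<^sup>2 * (t * (-2))) *\<^sub>R (x - c))"
  have "\<forall>x. GDERIV (ball_bump c r t) x :> \<phi>' x"
    unfolding \<phi>'_def m_def by (intro allI GDERIV_ball_bump)
  moreover have "continuous_on UNIV \<phi>'"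
  proof -
    have m: "continuous_on UNIV m"
      unfolding m_def
      by (intro continuous_on_max continuous_on_const continuous_on_mult continuous_on_diff
          continuous_on_inner continuous_on_id)
    have "(1 + (m x)\<^sup>2)\<^sup>2 \<noteq> 0" for x
      using one_plus_power2_pos[of "m x"] by simp
    then show ?thesis
      unfolding \<phi>'_def
      by (intro continuous_on_scaleR continuous_on_mult continuous_on_divide continuous_on_const
          continuous_on_power continuous_on_add continuous_on_diff continuous_on_id m ballI)
  qed
  moreover have "\<forall>x. x \<notin> cball c r \<longrightarrow> ball_bump c r t x = 0"
    using assms by (auto intro!: ball_bump_eq_0)
  ultimately have "test_function \<Omega> (ball_bump c r t) \<phi>'"
    unfolding test_function_def using assms(3)
    by (intro conjI exI[of _ "cball c r"] compact_cball)
  then show ?thesis by (intro exI[of _ \<phi>'])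
qed

lemma integral_ball_eq_0_if_orthogonal:
  fixes \<Omega> :: "(real^'n) set"
  assumes g: "integrable (lebesgue_on \<Omega>) g" and "0 < r" "cball c r \<subseteq> \<Omega>"
    and orth: "\<And>\<phi> \<phi>'. test_function \<Omega> \<phi> \<phi>' \<Longrightarrow> (LINT x|lebesgue_on \<Omega>. g x * \<phi> x) = 0"
  shows "(LINT x|lebesgue_on \<Omega>. g x * indicator (ball c r) x) = 0"
proof -
  have "(\<lambda>k. LINT x|lebesgue_on \<Omega>. g x * ball_bump c r (real k) x)
      \<longlonglongrightarrow> (LINT x|lebesgue_on \<Omega>. g x * indicator (ball c r) x)"
  proof (rule integral_dominated_convergence)
    have bb: "ball_bump c r (real k) \<in> borel_measurable (lebesgue_on \<Omega>)" for k
      by (intro measurable_restrict_space1 lebesgue_measurable_continuous continuous_on_ball_bump)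
    then show "(\<lambda>x. g x * ball_bump c r (real k) x) \<in> borel_measurable (lebesgue_on \<Omega>)" for k
      using g by (intro borel_measurable_times) auto
    have "indicator (ball c r) \<in> borel_measurable (lebesgue_on \<Omega>)"
      by (intro measurable_restrict_space1 borel_measurable_indicator) auto
    then show "(\<lambda>x. g x * indicator (ball c r) x) \<in> borel_measurable (lebesgue_on \<Omega>)"
      using g by (intro borel_measurable_times) auto
    show "integrable (lebesgue_on \<Omega>) (\<lambda>x. \<bar>g x\<bar>)" using g by simp
    show "AE x in lebesgue_on \<Omega>. (\<lambda>k. g x * ball_bump c r (real k) x) \<longlonglongrightarrow> g x * indicator (ball c r) x"
      by (intro AE_I2 tendsto_mult tendsto_const ball_bump_tendsto[OF \<open>0 < r\<close>])
    show "AE x in lebesgue_on \<Omega>. norm (g x * ball_bump c r (real k) x) \<le> \<bar>g x\<bar>" for k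
      by (intro AE_I2) (simp add: abs_mult mult_left_le abs_ball_bump_le_1)
  qed
  moreover have "(LINT x|lebesgue_on \<Omega>. g x * ball_bump c r (real k) x) = 0" for k
  proof -
    obtain \<phi>' where "test_function \<Omega> (ball_bump c r (real k)) \<phi>'"
      using test_function_ball_bump[OF \<open>0 < r\<close> _ \<open>cball c r \<subseteq> \<Omega>\<close>, of "real k"] by auto
    then show ?thesis by (rule orth)
  qed
  ultimately have "(\<lambda>k. 0) \<longlonglongrightarrow> (LINT x|lebesgue_on \<Omega>. g x * indicator (ball c r) x)" by simp
  then show ?thesis by (simp add: LIMSEQ_const_iff)
qed

text \<open>By Vitali's covering theorem an open set is, up to a null set, a countable disjoint union of balls
  whose closures lie in it.\<close>

lemma integral_open_eq_0_if_orthogonal: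
  fixes \<Omega> :: "(real^'n) set"
  assumes g: "integrable (lebesgue_on \<Omega>) g" and "open U" "U \<subseteq> \<Omega>" and \<Omega>: "\<Omega> \<in> sets lebesgue"
    and orth: "\<And>\<phi> \<phi>'. test_function \<Omega> \<phi> \<phi>' \<Longrightarrow> (LINT x|lebesgue_on \<Omega>. g x * \<phi> x) = 0"
  shows "(LINT x|lebesgue_on \<Omega>. g x * indicator U x) = 0"
proof -
  define K where "K = {(c, r). 0 < r \<and> cball c r \<subseteq> U}"
  have "\<exists>i. i \<in> K \<and> x \<in> ball (fst i) (snd i) \<and> snd i < d" if "x \<in> U" "0 < d" for x d
  proof -
    obtain e where "e > 0" "cball x e \<subseteq> U"
      using \<open>open U\<close> \<open>x \<in> U\<close> open_contains_cball by blast
    then have "cball x (min e (d/2)) \<subseteq> U" by auto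
    then have "(x, min e (d/2)) \<in> K" using \<open>e > 0\<close> \<open>d > 0\<close> by (auto simp: K_def)
    moreover have "x \<in> ball x (min e (d/2))" using \<open>e > 0\<close> \<open>d > 0\<close> by simp
    ultimately show ?thesis using \<open>d > 0\<close> by (intro exI[of _ "(x, min e (d/2))"]) auto
  qed
  then obtain C where C: "countable C" "C \<subseteq> K"
     "pairwise (\<lambda>i j. disjnt (ball (fst i) (snd i)) (ball (fst j) (snd j))) C"
     "negligible (U - (\<Union>i \<in> C. ball (fst i) (snd i)))"
    by (rule Vitali_covering_theorem_balls[of U K fst snd]) blast
  \<comment> \<open>\<open>C\<close> may be finite; the sequence of balls is padded with empty sets.\<close>
  define A where "A = (\<lambda>n. if n \<in> to_nat_on C ` C
     then ball (fst (from_nat_into C n)) (snd (from_nat_into C n)) else {})"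
  have disj: "disjoint_family A"
    unfolding disjoint_family_on_def
  proof (intro ballI impI)
    fix m n :: nat assume "m \<noteq> n"
    show "A m \<inter> A n = {}"
    proof (cases "m \<in> to_nat_on C ` C \<and> n \<in> to_nat_on C ` C")
      case True
      then obtain i j where ij: "i \<in> C" "j \<in> C" "m = to_nat_on C i" "n = to_nat_on C j" by auto
      then have "i \<noteq> j" using \<open>m \<noteq> n\<close> by auto
      with ij C(3) have "disjnt (ball (fst i) (snd i)) (ball (fst j) (snd j))"
        by (auto simp: pairwise_def)
      then show ?thesis using ij C(1) by (simp add: A_def disjnt_def)
    qed (auto simp: A_def)
  qed
  have UA: "(\<Union>n. A n) = (\<Union>i\<in>C. ball (fst i) (snd i))"
    using C(1) by (auto simp: A_def split: if_splits)
  have subU: "(\<Union>n. A n) \<subseteq> U"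
    unfolding UA using C(2) ball_subset_cball by (fastforce simp: K_def)
  have mA: "A n \<in> sets (lebesgue_on \<Omega>)" for n
  proof -
    have "A n \<subseteq> \<Omega>" using subU \<open>U \<subseteq> \<Omega>\<close> by blast
    moreover have "A n \<in> sets lebesgue" by (simp add: A_def)
    ultimately show ?thesis using \<Omega> by (simp add: sets_restrict_space_iff)
  qed
  have int0: "(LINT x:A n|lebesgue_on \<Omega>. g x) = 0" for n
  proof (cases "n \<in> to_nat_on C ` C")
    case True
    then obtain i where i: "i \<in> C" "n = to_nat_on C i" by auto
    then have "0 < snd i" "cball (fst i) (snd i) \<subseteq> \<Omega>"
      using C(2) \<open>U \<subseteq> \<Omega>\<close> unfolding K_def by (fastforce simp: case_prod_beta)+
    from integral_ball_eq_0_if_orthogonal[OF g this orth]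
    show ?thesis using i C(1) by (simp add: A_def set_lebesgue_integral_def mult.commute)
  qed (simp add: A_def set_lebesgue_integral_def)
  have "set_integrable (lebesgue_on \<Omega>) (\<Union>n. A n) g"
    unfolding set_integrable_def using g mA by (intro integrable_mult_indicator) auto
  from lebesgue_integral_countable_add[OF mA _ this] disj
  have "(LINT x:(\<Union>n. A n)|lebesgue_on \<Omega>. g x) = (\<Sum>n. LINT x:A n|lebesgue_on \<Omega>. g x)"
    by (auto simp: disjoint_family_on_def)
  then have "(LINT x:(\<Union>n. A n)|lebesgue_on \<Omega>. g x) = 0" by (simp add: int0)
  moreover have "(LINT x:(\<Union>n. A n)|lebesgue_on \<Omega>. g x) = (LINT x|lebesgue_on \<Omega>. g x * indicator U x)"
    unfolding set_lebesgue_integral_def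
  proof (rule integral_cong_AE)
    have "AE x in lebesgue. x \<notin> U - (\<Union>n. A n)"
      using C(4) unfolding UA negligible_iff_null_sets by (rule AE_not_in)
    then have "AE x in lebesgue_on \<Omega>. x \<notin> U - (\<Union>n. A n)"
      using \<Omega> by (subst AE_restrict_space_iff) (auto elim!: eventually_mono)
    then show "AE x in lebesgue_on \<Omega>. indicat_real (\<Union>n. A n) x *\<^sub>R g x = g x * indicator U x"
      by eventually_elim (use subU in \<open>auto simp: indicator_def\<close>)
    show "(\<lambda>x. indicat_real (\<Union>n. A n) x *\<^sub>R g x) \<in> borel_measurable (lebesgue_on \<Omega>)"
      using g mA by (intro borel_measurable_scaleR borel_measurable_indicator) auto
    have "U \<in> sets (lebesgue_on \<Omega>)"
      using \<open>U \<subseteq> \<Omega>\<close> \<open>open U\<close> \<Omega> by (simp add: sets_restrict_space_iff)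
    then show "(\<lambda>x. g x * indicat_real U x) \<in> borel_measurable (lebesgue_on \<Omega>)"
      using g by (intro borel_measurable_times borel_measurable_indicator) auto
  qed
  ultimately show ?thesis by simp
qed

text \<open>The set where \<open>g\<close> is positive is, up to a null set, a countable union of closed sets \<open>F n\<close>. The
  integral of \<open>g\<close> over each of them is a difference of integrals over open sets, hence zero, so each \<open>F n\<close>
  is a null set.\<close>

lemma AE_nonpos_if_orthogonal:
  fixes \<Omega> :: "(real^'n) set"
  assumes "open \<Omega>" and g: "integrable (lebesgue_on \<Omega>) g"
    and orth: "\<And>\<phi> \<phi>'. test_function \<Omega> \<phi> \<phi>' \<Longrightarrow> (LINT x|lebesgue_on \<Omega>. g x * \<phi> x) = 0"
  shows "AE x in lebesgue_on \<Omega>. g x \<le> 0"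
proof -
  have \<Omega>: "\<Omega> \<in> sets lebesgue" using \<open>open \<Omega>\<close> by simp
  define S where "S = {x \<in> \<Omega>. 0 < g x}"
  have "{x \<in> space (lebesgue_on \<Omega>). 0 < g x} \<in> sets (lebesgue_on \<Omega>)"
    using g by measurable
  then have "S \<in> sets lebesgue"
    using \<Omega> by (simp add: S_def sets_restrict_space_iff)
  then obtain C T where CT: "fsigma C" "T \<in> null_sets lebesgue" "C \<union> T = S"
    by (rule lebesgue_set_almost_fsigma)
  obtain F :: "nat \<Rightarrow> _" where F: "\<And>n. closed (F n)" "C = (\<Union>n. F n)"
    using CT(1) by (rule fsigma.cases) auto
  have "AE x in lebesgue_on \<Omega>. x \<notin> F n" for n
  proof -
    have FS: "F n \<subseteq> S" using F CT by blast
    have mF: "F n \<in> sets (lebesgue_on \<Omega>)"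
      using FS F(1)[of n] \<Omega> by (auto simp: sets_restrict_space_iff S_def)
    have i1: "integrable (lebesgue_on \<Omega>) (\<lambda>x. g x * indicator (F n) x)"
      using integrable_mult_indicator[OF mF g] by (simp add: mult.commute)
    have "(LINT x|lebesgue_on \<Omega>. g x * indicator \<Omega> x) = 0"
      by (rule integral_open_eq_0_if_orthogonal[OF g \<open>open \<Omega>\<close> subset_refl \<Omega> orth])
    moreover have "(LINT x|lebesgue_on \<Omega>. g x * indicator (\<Omega> - F n) x) = 0"
      using F(1)[of n] \<open>open \<Omega>\<close>
      by (intro integral_open_eq_0_if_orthogonal[OF g _ _ \<Omega> orth]) auto
    moreover have "(LINT x|lebesgue_on \<Omega>. g x * indicator (F n) x)
       = (LINT x|lebesgue_on \<Omega>. g x * indicator \<Omega> x) - (LINT x|lebesgue_on \<Omega>. g x * indicator (\<Omega> - F n) x)"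
    proof -
      have m: "\<Omega> \<in> sets (lebesgue_on \<Omega>)" "\<Omega> - F n \<in> sets (lebesgue_on \<Omega>)"
        using mF \<Omega> by (auto simp: sets_restrict_space_iff)
      have "(\<lambda>x. g x * indicator (F n) x) = (\<lambda>x. g x * indicator \<Omega> x - g x * indicator (\<Omega> - F n) x)"
        using FS by (auto simp: indicator_def S_def fun_eq_iff)
      then show ?thesis
        using integrable_mult_indicator[OF m(1) g] integrable_mult_indicator[OF m(2) g]
        by (simp add: mult.commute)
    qed
    ultimately have "(LINT x|lebesgue_on \<Omega>. g x * indicator (F n) x) = 0" by simp
    moreover have "AE x in lebesgue_on \<Omega>. 0 \<le> g x * indicator (F n) x"
      using FS by (intro AE_I2) (auto simp: indicator_def S_def)
    ultimately have "AE x in lebesgue_on \<Omega>. g x * indicator (F n) x = 0"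
      using integral_nonneg_eq_0_iff_AE[OF i1] by simp
    then show ?thesis
      by eventually_elim (use FS in \<open>auto simp: indicator_def S_def\<close>)
  qed
  then have "AE x in lebesgue_on \<Omega>. \<forall>n. x \<notin> F n" by (simp add: AE_all_countable)
  moreover have "AE x in lebesgue_on \<Omega>. x \<notin> T"
    using AE_not_in[OF CT(2)] \<Omega>
    by (subst AE_restrict_space_iff) (auto elim!: eventually_mono)
  moreover have "AE x in lebesgue_on \<Omega>. x \<in> \<Omega>"
    using AE_space[of "lebesgue_on \<Omega>"] by simp
  ultimately show ?thesis
    by eventually_elim (use CT(3) F(2) in \<open>auto simp: S_def not_less\<close>)
qed

lemma AE_eq_0_if_orthogonal:
  fixes \<Omega> :: "(real^'n) set"
  assumes "open \<Omega>" and g: "integrable (lebesgue_on \<Omega>) g"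
    and orth: "\<And>\<phi> \<phi>'. test_function \<Omega> \<phi> \<phi>' \<Longrightarrow> (LINT x|lebesgue_on \<Omega>. g x * \<phi> x) = 0"
  shows "AE x in lebesgue_on \<Omega>. g x = 0"
proof -
  have "AE x in lebesgue_on \<Omega>. g x \<le> 0"
    by (rule AE_nonpos_if_orthogonal[OF assms])
  moreover have "AE x in lebesgue_on \<Omega>. - g x \<le> 0"
    by (rule AE_nonpos_if_orthogonal) (use assms in auto)
  ultimately show ?thesis by eventually_elim simp
qed

section \<open>Difference quotients of Lipschitz functions\<close>

text \<open>The difference quotient of \<open>f\<close> with signed step \<open>s\<close> in direction \<open>e\<close>. Negative steps give backward
  quotients; the value at \<open>s = 0\<close> is \<open>0\<close>.\<close>

definition diff_quot :: "real \<Rightarrow> 'a::real_vector \<Rightarrow> ('a \<Rightarrow> real) \<Rightarrow> 'a \<Rightarrow> real" where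
  "diff_quot s e f x = (f (x + s *\<^sub>R e) - f x) / s"

lemma diff_quot_commute:
  "diff_quot s e (diff_quot t d f) x = diff_quot t d (diff_quot s e f) x"
proof -
  have second: "diff_quot s e (diff_quot t d f) x
      = (f (x + s *\<^sub>R e + t *\<^sub>R d) - f (x + s *\<^sub>R e) - f (x + t *\<^sub>R d) + f x) / (t * s)" for s e t d
    by (simp add: diff_quot_def diff_divide_distrib[symmetric] divide_divide_eq_left)
  have swap: "x + s *\<^sub>R e + t *\<^sub>R d = x + t *\<^sub>R d + s *\<^sub>R e"
    by (simp only: ac_simps)
  show ?thesis
    unfolding second[of s e t d] second[of t d s e] swap mult.commute[of t s] by simp
qed

lemma diff_quot_0 [simp]: "diff_quot 0 e f = (\<lambda>x. 0)"
  by (simp add: diff_quot_def fun_eq_iff)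

lemma continuous_on_diff_quot:
  fixes f :: "'a::real_normed_vector \<Rightarrow> real"
  assumes "continuous_on UNIV f"
  shows "continuous_on UNIV (diff_quot s e f)"
proof (cases "s = 0")
  case False
  have "continuous_on UNIV (\<lambda>x. f (x + s *\<^sub>R e))"
    by (rule continuous_on_compose2[OF assms]) (intro continuous_on_add continuous_on_id continuous_on_const subset_UNIV)+
  then show ?thesis
    unfolding diff_quot_def[abs_def] using assms False
    by (intro continuous_on_divide continuous_on_diff continuous_on_const) auto
qed simp

lemma diff_quot_support:
  fixes f :: "'a::real_normed_vector \<Rightarrow> real"
  assumes "\<And>x. f x \<noteq> 0 \<Longrightarrow> norm x \<le> R" and "diff_quot s e f x \<noteq> 0"
  shows "norm x \<le> R + \<bar>s\<bar> * norm e"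
proof -
  have "f (x + s *\<^sub>R e) \<noteq> 0 \<or> f x \<noteq> 0" using assms(2) by (auto simp: diff_quot_def)
  then show ?thesis
  proof
    assume "f (x + s *\<^sub>R e) \<noteq> 0"
    then have "norm (x + s *\<^sub>R e) \<le> R" by (rule assms(1))
    then show ?thesis using norm_diff_ineq[of x "s *\<^sub>R e"] by simp
  next
    assume "f x \<noteq> 0"
    then have "norm x \<le> R" by (rule assms(1))
    then show ?thesis by (rule order_trans) simp
  qed
qed

lemma integrable_continuous_bounded_support:
  fixes f :: "'a::euclidean_space \<Rightarrow> real"
  assumes "continuous_on UNIV f" "bounded {x. f x \<noteq> 0}"
  shows "integrable lebesgue f"
proof -
  obtain R where R: "\<And>x. f x \<noteq> 0 \<Longrightarrow> norm x \<le> R" using assms by (auto simp: bounded_iff)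
  have "integrable lborel (\<lambda>x. indicator (cball 0 R) x *\<^sub>R f x)"
    by (intro borel_integrable_compact compact_cball continuous_on_subset[OF assms(1)] subset_UNIV)
  moreover have "(\<lambda>x. indicator (cball 0 R) x *\<^sub>R f x) = f"
    using R by (auto simp: indicator_def fun_eq_iff)
  ultimately have "integrable lborel f" by simp
  then show ?thesis by (subst integrable_completion) auto
qed

lemma integral_lebesgue_translate:
  fixes f :: "'a::euclidean_space \<Rightarrow> real"
  assumes "continuous_on UNIV f"
  shows "(LINT x|lebesgue. f (x + a)) = (LINT x|lebesgue. f x)"
proof -
  have f: "f \<in> borel_measurable borel" by (rule borel_measurable_continuous_onI[OF assms])
  have "(LINT x|lborel. f x) = (LINT x|distr lborel borel ((+) a). f x)"
    by (simp only: lborel_distr_plus)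
  also have "\<dots> = (LINT x|lborel. f (a + x))"
    using f by (intro integral_distr) auto
  finally have "(LINT x|lborel. f x) = (LINT x|lborel. f (x + a))" by (simp add: add.commute)
  then show ?thesis
    using f by (simp add: integral_completion)
qed

lemma integral_diff_quot_parts:
  fixes f g :: "'a::euclidean_space \<Rightarrow> real"
  assumes f: "continuous_on UNIV f" "bounded {x. f x \<noteq> 0}" and g: "continuous_on UNIV g"
  shows "(LINT x|lebesgue. diff_quot s e f x * g x) = - (LINT x|lebesgue. f x * diff_quot (- s) e g x)"
proof -
  define h where "h = (\<lambda>x. f (x + s *\<^sub>R e) * g x)"
  obtain R where R: "\<And>x. f x \<noteq> 0 \<Longrightarrow> norm x \<le> R" using f by (auto simp: bounded_iff)
  have shift: "continuous_on UNIV (\<lambda>x. F (x + a))" if "continuous_on UNIV F" for F :: "'a \<Rightarrow> real" and a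
    by (rule continuous_on_compose2[OF that]) (intro continuous_on_add continuous_on_id continuous_on_const subset_UNIV)+
  have h: "continuous_on UNIV h"
    unfolding h_def by (intro continuous_on_mult shift f g)
  have "norm x \<le> R + norm (s *\<^sub>R e)" if "h x \<noteq> 0" for x
  proof -
    have "norm (x + s *\<^sub>R e) \<le> R" using that R by (simp add: h_def)
    then show ?thesis using norm_diff_ineq[of x "s *\<^sub>R e"] by linarith
  qed
  then have "bounded {x. h x \<noteq> 0}" by (intro boundedI) auto
  with h have ih: "integrable lebesgue h" by (rule integrable_continuous_bounded_support)
  have "bounded {x. f x * k x \<noteq> 0}" for k :: "'a \<Rightarrow> real"
    by (rule bounded_subset[OF f(2)]) auto
  then have ifg: "integrable lebesgue (\<lambda>x. f x * k x)" if "continuous_on UNIV k" for k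
    by (intro integrable_continuous_bounded_support continuous_on_mult f that)
  have "(LINT x|lebesgue. h x) = (LINT x|lebesgue. h (x + - (s *\<^sub>R e)))"
    by (rule integral_lebesgue_translate[OF h, symmetric])
  also have "\<dots> = (LINT x|lebesgue. f x * g (x - s *\<^sub>R e))" by (simp add: h_def)
  finally have eq: "(LINT x|lebesgue. h x) = (LINT x|lebesgue. f x * g (x - s *\<^sub>R e))" .
  have ifs: "integrable lebesgue (\<lambda>x. f x * g (x - s *\<^sub>R e))"
    using ifg[OF shift[OF g, of "- (s *\<^sub>R e)"]] by simp
  have "(LINT x|lebesgue. diff_quot s e f x * g x) = (LINT x|lebesgue. (h x - f x * g x) / s)"
    by (simp add: diff_quot_def h_def left_diff_distrib)
  also have "\<dots> = ((LINT x|lebesgue. h x) - (LINT x|lebesgue. f x * g x)) / s"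
    using ih ifg[OF g] by simp
  also have "\<dots> = ((LINT x|lebesgue. f x * g (x - s *\<^sub>R e)) - (LINT x|lebesgue. f x * g x)) / s"
    by (simp only: eq)
  also have "\<dots> = (LINT x|lebesgue. (f x * g (x - s *\<^sub>R e) - f x * g x) / s)"
    using ifs ifg[OF g] by simp
  also have "\<dots> = (LINT x|lebesgue. - (f x * diff_quot (- s) e g x))"
    by (simp add: diff_quot_def right_diff_distrib)
  finally show ?thesis by simp
qed

text \<open>Integrating by parts moves \<open>diff_quot s e\<close> from \<open>f\<close> to \<open>g\<close>, where difference quotients commute.
  The forward step on \<open>f\<close> has to be paired with the backward step on \<open>g\<close>.\<close>

lemma integral_diff_quot_swap:
  fixes f g :: "'a::euclidean_space \<Rightarrow> real"
  assumes f: "continuous_on UNIV f" "bounded {x. f x \<noteq> 0}" and g: "continuous_on UNIV g"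
  shows "(LINT x|lebesgue. diff_quot s e f x * diff_quot (- s) d g x)
       = (LINT x|lebesgue. diff_quot s d f x * diff_quot (- s) e g x)"
  using integral_diff_quot_parts[OF f continuous_on_diff_quot[OF g]]
  by (simp add: diff_quot_commute[of "- s" e "- s" d])

lemma diff_quot_tendsto:
  fixes f :: "'a::real_inner \<Rightarrow> real"
  assumes "GDERIV f x :> D" "s \<longlonglongrightarrow> 0" "\<And>k. s k \<noteq> 0"
  shows "(\<lambda>k. diff_quot (s k) e f x) \<longlonglongrightarrow> e \<bullet> D"
proof -
  have 1: "((\<lambda>t. x + t *\<^sub>R e) has_derivative (\<lambda>t. t *\<^sub>R e)) (at 0)"
    by (rule has_derivative_eq_rhs, (rule derivative_intros)+) simp
  have 2: "(f has_derivative (\<lambda>h. h \<bullet> D)) (at (x + 0 *\<^sub>R e))"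
    using assms(1) by (simp add: gderiv_def)
  have "((\<lambda>t. f (x + t *\<^sub>R e)) has_derivative (\<lambda>t. (t *\<^sub>R e) \<bullet> D)) (at 0)"
    using has_derivative_compose[OF 1 2] .
  then have "DERIV (\<lambda>t. f (x + t *\<^sub>R e)) 0 :> e \<bullet> D"
    by (simp add: has_field_derivative_def mult.commute[of _ "e \<bullet> D"] mult_commute_abs)
  then have "((\<lambda>t. (f (x + t *\<^sub>R e) - f x) / t) \<longlongrightarrow> e \<bullet> D) (at 0)"
    by (simp add: DERIV_def)
  moreover have "filterlim s (at 0) sequentially"
    using assms by (simp add: filterlim_at)
  ultimately show ?thesis
    unfolding diff_quot_def by (rule filterlim_compose)
qed

lemma abs_diff_quot_le:
  fixes f :: "'a::real_normed_vector \<Rightarrow> real"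
  assumes "L-lipschitz_on UNIV f"
  shows "\<bar>diff_quot s e f x\<bar> \<le> L * norm e"
proof (cases "s = 0")
  case True
  then show ?thesis using lipschitz_on_nonneg[OF assms] by simp
next
  case False
  have "\<bar>f (x + s *\<^sub>R e) - f x\<bar> \<le> L * norm (s *\<^sub>R e)"
    using lipschitz_onD[OF assms, of "x + s *\<^sub>R e" x] by (simp add: dist_norm)
  then show ?thesis using False by (simp add: diff_quot_def divide_le_eq mult_ac)
qed

text \<open>\<open>f\<close> is Lipschitz with bounded support, and \<open>f'\<close> is a measurable function that agrees almost
  everywhere with its gradient. Almost everywhere differentiability is part of the notion; it is not derived
  from the Lipschitz condition by Rademacher's theorem, since it is evident for piecewise affine functions.\<close>

definition ae_gradient :: "('a::euclidean_space \<Rightarrow> real) \<Rightarrow> ('a \<Rightarrow> 'a) \<Rightarrow> bool" where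
  "ae_gradient f f' \<longleftrightarrow>
     (\<exists>L. L-lipschitz_on UNIV f) \<and> bounded {x. f x \<noteq> 0} \<and>
     f' \<in> borel_measurable lebesgue \<and> (AE x in lebesgue. GDERIV f x :> f' x)"

lemma ae_gradient_continuous: "ae_gradient f f' \<Longrightarrow> continuous_on UNIV f"
  unfolding ae_gradient_def using lipschitz_on_continuous_on by blast

lemma norm_gradient_le_lipschitz:
  fixes f :: "'a::real_inner \<Rightarrow> real"
  assumes "GDERIV f x :> D" "L-lipschitz_on UNIV f"
  shows "norm D \<le> L"
proof (cases "D = 0")
  case False
  \<comment> \<open>Difference quotients in the direction of the gradient itself.\<close>
  have "(\<lambda>k. diff_quot (1 / real (Suc k)) D f x) \<longlonglongrightarrow> D \<bullet> D"
    by (intro diff_quot_tendsto[OF assms(1)] LIMSEQ_Suc lim_1_over_n) simp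
  moreover have "diff_quot (1 / real (Suc k)) D f x \<le> L * norm D" for k
    using abs_diff_quot_le[OF assms(2), of "1 / real (Suc k)" D x] by linarith
  ultimately have "D \<bullet> D \<le> L * norm D" by (intro LIMSEQ_le_const2) auto
  then have "norm D * norm D \<le> L * norm D" by (simp add: dot_square_norm power2_eq_square)
  then show ?thesis using False by simp
qed (use lipschitz_on_nonneg[OF assms(2)] in simp)

text \<open>One constant and one ball serve for \<open>f\<close>, its gradient and its difference quotients, so that the
  dominated convergence theorem applies to products of any of them.\<close>

lemma ae_gradient_bound:
  assumes "ae_gradient f f'"
  obtains L R where "0 \<le> L" "\<And>x. \<bar>f x\<bar> \<le> L * indicator (cball 0 R) x"
    "AE x in lebesgue. norm (f' x) \<le> L * indicator (cball 0 R) x"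
    "\<And>s e x. \<bar>s\<bar> \<le> 1 \<Longrightarrow> norm e \<le> 1 \<Longrightarrow> \<bar>diff_quot s e f x\<bar> \<le> L * indicator (cball 0 R) x"
proof -
  obtain L R where L: "L-lipschitz_on UNIV f" and R: "\<And>x. f x \<noteq> 0 \<Longrightarrow> norm x \<le> R"
    and ae: "AE x in lebesgue. GDERIV f x :> f' x"
    using assms by (auto simp: ae_gradient_def bounded_iff)
  have "bounded (range f)"
  proof -
    have "compact (f ` cball 0 R)"
      by (intro compact_continuous_image compact_cball continuous_on_subset[OF ae_gradient_continuous[OF assms]] subset_UNIV)
    then have "bounded (insert 0 (f ` cball 0 R))" by (simp add: compact_imp_bounded)
    then show ?thesis by (rule bounded_subset) (use R in force)
  qed
  then obtain B where B: "\<And>x. \<bar>f x\<bar> \<le> B" by (auto simp: bounded_iff)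
  have "0 \<le> L" using L by (rule lipschitz_on_nonneg)
  have "0 \<le> B" using B[of 0] by linarith
  show thesis
  proof (rule that[of "L + B" "R + 1"])
    show "0 \<le> L + B" using \<open>0 \<le> L\<close> \<open>0 \<le> B\<close> by simp
    show "\<bar>f x\<bar> \<le> (L + B) * indicator (cball 0 (R + 1)) x" for x
      using B[of x] R[of x] \<open>0 \<le> L\<close> by (cases "f x = 0") (auto simp: indicator_def)
    show "AE x in lebesgue. norm (f' x) \<le> (L + B) * indicator (cball 0 (R + 1)) x"
      using ae
    proof eventually_elim
      case (elim x)
      show ?case
      proof (cases "norm x \<le> R + 1")
        case True
        then show ?thesis
          using norm_gradient_le_lipschitz[OF elim L] \<open>0 \<le> B\<close> by simp
      next
        case False
        \<comment> \<open>Outside the ball \<open>f\<close> vanishes near \<open>x\<close>, so its gradient is zero.\<close>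
        have "\<forall>\<^sub>F y in nhds x. y \<in> {y. R < norm y}"
          using False by (intro eventually_nhds_in_open open_Collect_less continuous_on_norm_id continuous_on_const) auto
        then have "\<forall>\<^sub>F y in nhds x. f y = 0" by eventually_elim (use R in force)
        then have "(f has_derivative (\<lambda>h. 0)) (at x)"
          by (intro has_derivative_transform_eventually[of "\<lambda>_. 0" _ x UNIV f])
            (auto dest: eventually_nhds_x_imp_x simp: eventually_at_filter elim!: eventually_mono)
        then have "(\<lambda>h. h \<bullet> f' x) = (\<lambda>h. 0)"
          using elim has_derivative_unique unfolding gderiv_def by blast
        then have "f' x \<bullet> f' x = 0" by (rule fun_cong)
        then show ?thesis using \<open>0 \<le> L\<close> \<open>0 \<le> B\<close> by simp
      qed
    qed
    show "\<bar>diff_quot s e f x\<bar> \<le> (L + B) * indicator (cball 0 (R + 1)) x"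
      if "\<bar>s\<bar> \<le> 1" "norm e \<le> 1" for s e x
    proof (cases "diff_quot s e f x = 0")
      case False
      have "\<bar>s\<bar> * norm e \<le> 1" using that by (simp add: mult_le_one)
      with diff_quot_support[OF R False] have "norm x \<le> R + 1" by linarith
      moreover have "\<bar>diff_quot s e f x\<bar> \<le> L + B"
        using abs_diff_quot_le[OF L, of s e x] mult_left_le[OF that(2) \<open>0 \<le> L\<close>] \<open>0 \<le> B\<close> by linarith
      ultimately show ?thesis by simp
    qed (use \<open>0 \<le> L\<close> \<open>0 \<le> B\<close> in simp)
  qed
qed

lemma integral_tendsto_bounded_support:
  fixes F :: "nat \<Rightarrow> 'a::euclidean_space \<Rightarrow> real"
  assumes "\<And>k. F k \<in> borel_measurable lebesgue" "f \<in> borel_measurable lebesgue"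
    and "AE x in lebesgue. (\<lambda>k. F k x) \<longlonglongrightarrow> f x"
    and "\<And>k x. \<bar>F k x\<bar> \<le> C * indicator (cball 0 R) x"
  shows "(\<lambda>k. LINT x|lebesgue. F k x) \<longlonglongrightarrow> (LINT x|lebesgue. f x)"
proof (rule integral_dominated_convergence)
  have "cball (0::'a) R \<in> lmeasurable" by simp
  then have "integrable lebesgue (indicat_real (cball (0::'a) R))"
    by (intro integrable_real_indicator) (auto simp: fmeasurable_def)
  then show "integrable lebesgue (\<lambda>x. C * indicat_real (cball (0::'a) R) x)" by simp
qed (use assms in auto)

lemma abs_mult_le_indicator:
  fixes a b :: real
  assumes "\<bar>a\<bar> \<le> L * indicator A x" "\<bar>b\<bar> \<le> M * indicator B x" "0 \<le> L" "0 \<le> M"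
  shows "\<bar>a * b\<bar> \<le> L * M * indicator A x"
proof -
  have "\<bar>a\<bar> * \<bar>b\<bar> \<le> (L * indicator A x) * (M * indicator B x)"
    using assms by (intro mult_mono) auto
  also have "\<dots> \<le> L * M * indicator A x"
    using assms(3,4) by (auto simp: indicator_def)
  finally show ?thesis by (simp add: abs_mult)
qed

lemma integral_gradient_by_parts:
  assumes f: "ae_gradient f f'" and g: "ae_gradient g g'" and "norm e \<le> 1"
  shows "(LINT x|lebesgue. (e \<bullet> f' x) * g x) = - (LINT x|lebesgue. f x * (e \<bullet> g' x))"
proof -
  define s where "s = (\<lambda>k. 1 / real (Suc k))"
  have s: "s \<longlonglongrightarrow> 0" "(\<lambda>k. - s k) \<longlonglongrightarrow> 0" "\<And>k. s k \<noteq> 0" "\<And>k. - s k \<noteq> 0" "\<And>k. \<bar>s k\<bar> \<le> 1" "\<And>k. \<bar>- s k\<bar> \<le> 1"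
    using LIMSEQ_Suc[OF lim_1_over_n[where 'a=real]] tendsto_minus[OF LIMSEQ_Suc[OF lim_1_over_n[where 'a=real]]]
    by (simp_all add: s_def)
  obtain L R where L: "0 \<le> L" "\<And>x. \<bar>f x\<bar> \<le> L * indicator (cball 0 R) x"
    "\<And>s e x. \<bar>s\<bar> \<le> 1 \<Longrightarrow> norm e \<le> 1 \<Longrightarrow> \<bar>diff_quot s e f x\<bar> \<le> L * indicator (cball 0 R) x"
    using ae_gradient_bound[OF f] by metis
  obtain M Q where M: "0 \<le> M" "\<And>x. \<bar>g x\<bar> \<le> M * indicator (cball 0 Q) x"
    "\<And>s e x. \<bar>s\<bar> \<le> 1 \<Longrightarrow> norm e \<le> 1 \<Longrightarrow> \<bar>diff_quot s e g x\<bar> \<le> M * indicator (cball 0 Q) x"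
    using ae_gradient_bound[OF g] by metis
  have meas [measurable]: "f \<in> borel_measurable lebesgue" "g \<in> borel_measurable lebesgue"
    "f' \<in> borel_measurable lebesgue" "g' \<in> borel_measurable lebesgue"
    "diff_quot r e f \<in> borel_measurable lebesgue" "diff_quot r e g \<in> borel_measurable lebesgue" for r
    using f g by (auto intro!: lebesgue_measurable_continuous continuous_on_diff_quot ae_gradient_continuous[OF f] ae_gradient_continuous[OF g] simp: ae_gradient_def)
  have aef: "AE x in lebesgue. GDERIV f x :> f' x" and aeg: "AE x in lebesgue. GDERIV g x :> g' x"
    using f g by (auto simp: ae_gradient_def)
  have "(\<lambda>k. LINT x|lebesgue. diff_quot (s k) e f x * g x) \<longlonglongrightarrow> (LINT x|lebesgue. (e \<bullet> f' x) * g x)"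
  proof (rule integral_tendsto_bounded_support[OF _ _ _ abs_mult_le_indicator[where L = L and M = M and A = "cball 0 R" and B = "cball 0 Q"]])
    show "AE x in lebesgue. (\<lambda>k. diff_quot (s k) e f x * g x) \<longlonglongrightarrow> (e \<bullet> f' x) * g x"
      using aef by eventually_elim (intro tendsto_intros diff_quot_tendsto s)
  qed (use meas \<open>norm e \<le> 1\<close> in \<open>simp_all add: L M s\<close>)
  moreover have "(\<lambda>k. LINT x|lebesgue. f x * diff_quot (- s k) e g x) \<longlonglongrightarrow> (LINT x|lebesgue. f x * (e \<bullet> g' x))"
  proof (rule integral_tendsto_bounded_support[OF _ _ _ abs_mult_le_indicator[where L = L and M = M and A = "cball 0 R" and B = "cball 0 Q"]])
    show "AE x in lebesgue. (\<lambda>k. f x * diff_quot (- s k) e g x) \<longlonglongrightarrow> f x * (e \<bullet> g' x)"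
      using aeg by eventually_elim (intro tendsto_intros diff_quot_tendsto s)
  qed (use meas \<open>norm e \<le> 1\<close> in \<open>simp_all add: L M s\<close>)
  then have "(\<lambda>k. - (LINT x|lebesgue. f x * diff_quot (- s k) e g x)) \<longlonglongrightarrow> - (LINT x|lebesgue. f x * (e \<bullet> g' x))"
    by (rule tendsto_minus)
  moreover have "(LINT x|lebesgue. diff_quot (s k) e f x * g x) = - (LINT x|lebesgue. f x * diff_quot (- s k) e g x)" for k
    using f by (intro integral_diff_quot_parts ae_gradient_continuous[OF f] ae_gradient_continuous[OF g])
      (simp add: ae_gradient_def)
  ultimately show ?thesis by (simp add: LIMSEQ_unique)
qed

text \<open>For functions of class $C^2$ this is integration by parts twice. Here it is the limit of
  \<open>integral_diff_quot_swap\<close> as the step tends to zero.\<close>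

lemma integral_gradient_swap:
  assumes f: "ae_gradient f f'" and g: "ae_gradient g g'" and "norm e \<le> 1" "norm d \<le> 1"
  shows "(LINT x|lebesgue. (e \<bullet> f' x) * (d \<bullet> g' x)) = (LINT x|lebesgue. (d \<bullet> f' x) * (e \<bullet> g' x))"
proof -
  define s where "s = (\<lambda>k. 1 / real (Suc k))"
  have s: "s \<longlonglongrightarrow> 0" "(\<lambda>k. - s k) \<longlonglongrightarrow> 0" "\<And>k. s k \<noteq> 0" "\<And>k. - s k \<noteq> 0" "\<And>k. \<bar>s k\<bar> \<le> 1" "\<And>k. \<bar>- s k\<bar> \<le> 1"
    using LIMSEQ_Suc[OF lim_1_over_n[where 'a=real]] tendsto_minus[OF LIMSEQ_Suc[OF lim_1_over_n[where 'a=real]]]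
    by (simp_all add: s_def)
  obtain L R where L: "0 \<le> L"
    "\<And>s e x. \<bar>s\<bar> \<le> 1 \<Longrightarrow> norm e \<le> 1 \<Longrightarrow> \<bar>diff_quot s e f x\<bar> \<le> L * indicator (cball 0 R) x"
    using ae_gradient_bound[OF f] by metis
  obtain M Q where M: "0 \<le> M"
    "\<And>s e x. \<bar>s\<bar> \<le> 1 \<Longrightarrow> norm e \<le> 1 \<Longrightarrow> \<bar>diff_quot s e g x\<bar> \<le> M * indicator (cball 0 Q) x"
    using ae_gradient_bound[OF g] by metis
  have meas [measurable]: 
    "f' \<in> borel_measurable lebesgue" "g' \<in> borel_measurable lebesgue"
    "diff_quot r e f \<in> borel_measurable lebesgue" "diff_quot r e g \<in> borel_measurable lebesgue" for r e
    using f g by (auto intro!: lebesgue_measurable_continuous continuous_on_diff_quot ae_gradient_continuous[OF f] ae_gradient_continuous[OF g] simp: ae_gradient_def)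
  have aef: "AE x in lebesgue. GDERIV f x :> f' x" and aeg: "AE x in lebesgue. GDERIV g x :> g' x"
    using f g by (auto simp: ae_gradient_def)
  have lim: "(\<lambda>k. LINT x|lebesgue. diff_quot (s k) e f x * diff_quot (- s k) d g x)
      \<longlonglongrightarrow> (LINT x|lebesgue. (e \<bullet> f' x) * (d \<bullet> g' x))" if "norm e \<le> 1" "norm d \<le> 1" for e d
  proof (rule integral_tendsto_bounded_support[OF _ _ _ abs_mult_le_indicator[where L = L and M = M and A = "cball 0 R" and B = "cball 0 Q"]])
    show "AE x in lebesgue. (\<lambda>k. diff_quot (s k) e f x * diff_quot (- s k) d g x) \<longlonglongrightarrow> (e \<bullet> f' x) * (d \<bullet> g' x)"
      using aef aeg by eventually_elim (intro tendsto_intros diff_quot_tendsto s)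
  qed (use meas that in \<open>simp_all add: L M s\<close>)
  have "(LINT x|lebesgue. diff_quot (s k) e f x * diff_quot (- s k) d g x)
     = (LINT x|lebesgue. diff_quot (s k) d f x * diff_quot (- s k) e g x)" for k
    using f by (intro integral_diff_quot_swap ae_gradient_continuous[OF f] ae_gradient_continuous[OF g])
      (simp add: ae_gradient_def)
  with lim[OF assms(3,4)] lim[OF assms(4,3)] show ?thesis
    by (simp add: LIMSEQ_unique)
qed

lemma integrable_gradient_mult:
  assumes f: "ae_gradient f f'" and g: "ae_gradient g g'"
  shows "integrable lebesgue (\<lambda>x. (e \<bullet> f' x) * (d \<bullet> g' x))"
proof -
  obtain L R where L: "0 \<le> L" "AE x in lebesgue. norm (f' x) \<le> L * indicator (cball 0 R) x"
    using ae_gradient_bound[OF f] by metis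
  obtain M Q where M: "0 \<le> M" "AE x in lebesgue. norm (g' x) \<le> M * indicator (cball 0 Q) x"
    using ae_gradient_bound[OF g] by metis
  show ?thesis
  proof (rule Bochner_Integration.integrable_bound)
    have "cball (0::'a) R \<in> lmeasurable" by simp
    then have "integrable lebesgue (indicat_real (cball (0::'a) R))"
      by (intro integrable_real_indicator) (auto simp: fmeasurable_def)
    then show "integrable lebesgue (\<lambda>x. (norm e * L) * (norm d * M) * indicat_real (cball (0::'a) R) x)" by simp
    have [measurable]: "f' \<in> borel_measurable lebesgue" "g' \<in> borel_measurable lebesgue"
      using f g by (auto simp: ae_gradient_def)
    show "(\<lambda>x. (e \<bullet> f' x) * (d \<bullet> g' x)) \<in> borel_measurable lebesgue" by measurable
    show "AE x in lebesgue. norm ((e \<bullet> f' x) * (d \<bullet> g' x))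
        \<le> norm ((norm e * L) * (norm d * M) * indicat_real (cball (0::'a) R) x)"
      using L(2) M(2)
    proof eventually_elim
      case (elim x)
      have "\<bar>e \<bullet> f' x\<bar> \<le> norm e * norm (f' x)" by (rule Cauchy_Schwarz_ineq2)
      also have "\<dots> \<le> norm e * (L * indicator (cball 0 R) x)" by (intro mult_left_mono elim norm_ge_zero)
      finally have 1: "\<bar>e \<bullet> f' x\<bar> \<le> norm e * (L * indicator (cball 0 R) x)" .
      have "\<bar>d \<bullet> g' x\<bar> \<le> norm d * norm (g' x)" by (rule Cauchy_Schwarz_ineq2)
      also have "\<dots> \<le> norm d * (M * indicator (cball 0 Q) x)" by (intro mult_left_mono elim norm_ge_zero)
      also have "\<dots> \<le> norm d * M" using M(1) by (auto simp: indicator_def)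
      finally have 2: "\<bar>d \<bullet> g' x\<bar> \<le> norm d * M" .
      have "\<bar>e \<bullet> f' x\<bar> * \<bar>d \<bullet> g' x\<bar> \<le> (norm e * (L * indicator (cball 0 R) x)) * (norm d * M)"
        using 1 2 L(1) by (intro mult_mono) auto
      then show ?case using L(1) M(1) by (simp add: abs_mult mult_ac)
    qed
  qed
qed

section \<open>Weak and classical gradients\<close>

lemma integrable_if_square_integrable:
  fixes f :: "'a \<Rightarrow> real"
  assumes "finite_measure M" and [measurable]: "f \<in> borel_measurable M" and "integrable M (\<lambda>x. (f x)\<^sup>2)"
  shows "integrable M f"
proof (rule Bochner_Integration.integrable_bound)
  show "integrable M (\<lambda>x. 1 + (f x)\<^sup>2)"
    using assms by (simp add: finite_measure.integrable_const)
  have "\<bar>f x\<bar> \<le> 1 + (f x)\<^sup>2" for x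
  proof (cases "\<bar>f x\<bar> \<le> 1")
    case True then show ?thesis using zero_le_power2[of "f x"] by linarith
  next
    case False
    then have "\<bar>f x\<bar> * 1 \<le> \<bar>f x\<bar> * \<bar>f x\<bar>" by (intro mult_left_mono) auto
    then show ?thesis by (simp add: power2_eq_square)
  qed
  then have "norm (f x) \<le> norm (1 + (f x)\<^sup>2)" for x
    unfolding real_norm_def by (rule order_trans[OF _ abs_ge_self])
  then show "AE x in M. norm (f x) \<le> norm (1 + (f x)\<^sup>2)" by (rule AE_I2)
qed measurable

lemma finite_measure_lebesgue_on_bounded:
  assumes "open \<Omega>" "bounded \<Omega>"
  shows "finite_measure (lebesgue_on \<Omega>)"
  using assms by (intro finite_measure_lebesgue_on bounded_set_imp_lmeasurable) auto

lemma inner_axis_axis: "A \<bullet> axis i (axis j 1) = (A :: real^'n^'m) $ i $ j"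
  unfolding inner_axis inner_real_def by (rule mult_1_right)

lemma component2_measurable:
  fixes G :: "'a \<Rightarrow> real^'n^'m"
  assumes "G \<in> borel_measurable M"
  shows "(\<lambda>x. G x $ i $ j) \<in> borel_measurable M"
proof -
  have "(\<lambda>x. G x \<bullet> axis i (axis j 1)) \<in> borel_measurable M"
    by (intro borel_measurable_inner assms borel_measurable_const)
  then show ?thesis unfolding inner_axis_axis .
qed

lemma measurable_matrix_if_components:
  fixes G :: "'a \<Rightarrow> real^'n^'m"
  assumes "\<And>i j. (\<lambda>x. G x $ i $ j) \<in> borel_measurable M"
  shows "G \<in> borel_measurable M"
proof (rule borel_measurable_euclidean_space[THEN iffD2], rule ballI)
  fix b :: "real^'n^'m" assume "b \<in> Basis"
  then obtain i u where b: "b = axis i u" "u \<in> Basis"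
    by (auto simp: Basis_vec_def)
  then obtain j where u: "u = axis j 1" by (auto simp: Basis_vec_def)
  show "(\<lambda>x. G x \<bullet> b) \<in> borel_measurable M"
    using assms[of i j] unfolding b(1) u inner_axis_axis by simp
qed

lemma norm_matrix_power2: "(norm (A :: real^'n^'m))\<^sup>2 = (\<Sum>i\<in>UNIV. \<Sum>j\<in>UNIV. (A $ i $ j)\<^sup>2)"
  unfolding power2_norm_eq_inner unfolding inner_vec_def inner_real_def power2_eq_square ..

lemma abs_component2_le_norm: "\<bar>A $ i $ j\<bar> \<le> norm (A :: real^'n^'m)"
  using component_le_norm_cart[of "A $ i" j] Finite_Cartesian_Product.norm_nth_le[of A i] by linarith

lemma integrable_component_of_square_integrable_field:
  fixes G :: "real^'n \<Rightarrow> real^'n^'n"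
  assumes "open \<Omega>" "bounded \<Omega>" "square_integrable_field \<Omega> G"
  shows "integrable (lebesgue_on \<Omega>) (\<lambda>x. G x $ i $ j)"
proof (rule integrable_if_square_integrable)
  show "finite_measure (lebesgue_on \<Omega>)"
    by (rule finite_measure_lebesgue_on_bounded[OF assms(1,2)])
  show m: "(\<lambda>x. G x $ i $ j) \<in> borel_measurable (lebesgue_on \<Omega>)"
    using assms by (intro component2_measurable) (simp add: square_integrable_field_def)
  show "integrable (lebesgue_on \<Omega>) (\<lambda>x. (G x $ i $ j)\<^sup>2)"
  proof (rule Bochner_Integration.integrable_bound)
    show "integrable (lebesgue_on \<Omega>) (\<lambda>x. (norm (G x))\<^sup>2)"
      using assms by (simp add: square_integrable_field_def)
    show "(\<lambda>x. (G x $ i $ j)\<^sup>2) \<in> borel_measurable (lebesgue_on \<Omega>)"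
      using m by (rule borel_measurable_power)
    show "AE x in lebesgue_on \<Omega>. norm ((G x $ i $ j)\<^sup>2) \<le> norm ((norm (G x))\<^sup>2)"
      by (intro AE_I2) (simp add: power2_le_iff_abs_le abs_component2_le_norm)
  qed
qed

text \<open>A $C^1$ function of compact support has bounded gradient and is therefore Lipschitz.\<close>

lemma test_function_ae_gradient:
  assumes "test_function \<Omega> \<phi> \<phi>'"
  shows "ae_gradient \<phi> \<phi>'"
proof -
  obtain K where K: "compact K" "K \<subseteq> \<Omega>" "\<And>x. x \<notin> K \<Longrightarrow> \<phi> x = 0"
    using assms by (auto simp: test_function_def)
  have der: "(\<phi> has_derivative (\<lambda>h. h \<bullet> \<phi>' x)) (at x)" for x
    using assms by (simp add: test_function_def gderiv_def)
  have cont: "continuous_on UNIV \<phi>'" using assms by (simp add: test_function_def)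
  have "bounded (\<phi>' ` K)"
    by (intro compact_imp_bounded compact_continuous_image K continuous_on_subset[OF cont] subset_UNIV)
  then obtain B where B: "\<And>x. x \<in> K \<Longrightarrow> norm (\<phi>' x) \<le> B" by (auto simp: bounded_iff)
  have "norm (\<phi>' x) \<le> \<bar>B\<bar>" for x
  proof (cases "x \<in> K")
    case True
    then show ?thesis using B[of x] by linarith
  next
    case False
    have "(\<phi> has_derivative (\<lambda>h. 0)) (at x)"
      by (rule has_derivative_transform_within_open[OF has_derivative_const, of "- K"])
        (use K False in \<open>auto simp: compact_imp_closed open_Compl\<close>)
    then have "(\<lambda>h. h \<bullet> \<phi>' x) = (\<lambda>h. 0)"
      using der has_derivative_unique by blast
    then have "\<phi>' x \<bullet> \<phi>' x = 0" by (rule fun_cong)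
    then show ?thesis by simp
  qed
  then have on: "onorm (\<lambda>h. h \<bullet> \<phi>' x) \<le> \<bar>B\<bar>" for x
    by (intro onorm_bound)
      (auto intro!: order_trans[OF Cauchy_Schwarz_ineq2] mult_left_mono simp: mult.commute[of "\<bar>B\<bar>"])
  have "\<bar>B\<bar>-lipschitz_on UNIV \<phi>"
    by (rule bounded_derivative_imp_lipschitz[OF der]) (use on in auto)
  moreover have "bounded {x. \<phi> x \<noteq> 0}"
    by (rule bounded_subset[OF compact_imp_bounded[OF K(1)]]) (use K(3) in auto)
  ultimately show ?thesis
    unfolding ae_gradient_def
    using assms lebesgue_measurable_continuous[OF cont] by (auto simp: test_function_def)
qed

lemma AE_weak_gradient_unique:
  fixes \<Omega> :: "(real^'n) set"
  assumes "open \<Omega>" "bounded \<Omega>" and G: "has_weak_gradient \<Omega> u G" and H: "has_weak_gradient \<Omega> u H"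
  shows "AE x in lebesgue_on \<Omega>. G x = H x"
proof -
  have "AE x in lebesgue_on \<Omega>. G x $ i $ j - H x $ i $ j = 0" for i j
  proof (rule AE_eq_0_if_orthogonal[OF \<open>open \<Omega>\<close>])
    have iG: "integrable (lebesgue_on \<Omega>) (\<lambda>x. G x $ i $ j)"
      using G by (intro integrable_component_of_square_integrable_field assms) (simp add: has_weak_gradient_def)
    have iH: "integrable (lebesgue_on \<Omega>) (\<lambda>x. H x $ i $ j)"
      using H by (intro integrable_component_of_square_integrable_field assms) (simp add: has_weak_gradient_def)
    show "integrable (lebesgue_on \<Omega>) (\<lambda>x. G x $ i $ j - H x $ i $ j)"
      using iG iH by simp
    fix \<phi> \<phi>' assume \<phi>: "test_function \<Omega> \<phi> \<phi>'"
    note g\<phi> = test_function_ae_gradient[OF \<phi>]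
    obtain B R where B: "0 \<le> B" "\<And>x. \<bar>\<phi> x\<bar> \<le> B * indicator (cball 0 R) x"
      using ae_gradient_bound[OF g\<phi>] by metis
    have B': "\<bar>\<phi> x\<bar> \<le> B" for x
      using B(2)[of x] B(1) by (cases "x \<in> cball 0 R") simp_all
    have m\<phi>: "\<phi> \<in> borel_measurable (lebesgue_on \<Omega>)"
      by (intro measurable_restrict_space1 lebesgue_measurable_continuous ae_gradient_continuous[OF g\<phi>])
    have int: "integrable (lebesgue_on \<Omega>) (\<lambda>x. F x * \<phi> x)" if F: "integrable (lebesgue_on \<Omega>) F" for F
    proof (rule Bochner_Integration.integrable_bound)
      show "integrable (lebesgue_on \<Omega>) (\<lambda>x. F x * B)" using F by simp
      show "(\<lambda>x. F x * \<phi> x) \<in> borel_measurable (lebesgue_on \<Omega>)" using F m\<phi> by simp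
      show "AE x in lebesgue_on \<Omega>. norm (F x * \<phi> x) \<le> norm (F x * B)"
        using B' B(1) by (intro AE_I2) (simp add: abs_mult mult_left_mono)
    qed
    have "(LINT x|lebesgue_on \<Omega>. (G x $ i $ j - H x $ i $ j) * \<phi> x)
        = (LINT x|lebesgue_on \<Omega>. G x $ i $ j * \<phi> x) - (LINT x|lebesgue_on \<Omega>. H x $ i $ j * \<phi> x)"
      using int[OF iG] int[OF iH] by (simp add: left_diff_distrib)
    moreover have "(LINT x|lebesgue_on \<Omega>. u x $ i * \<phi>' x $ j) = - (LINT x|lebesgue_on \<Omega>. G x $ i $ j * \<phi> x)"
      using G \<phi> unfolding has_weak_gradient_def by blast
    moreover have "(LINT x|lebesgue_on \<Omega>. u x $ i * \<phi>' x $ j) = - (LINT x|lebesgue_on \<Omega>. H x $ i $ j * \<phi> x)"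
      using H \<phi> unfolding has_weak_gradient_def by blast
    ultimately show "(LINT x|lebesgue_on \<Omega>. (G x $ i $ j - H x $ i $ j) * \<phi> x) = 0" by simp
  qed
  then have "AE x in lebesgue_on \<Omega>. \<forall>i j. G x $ i $ j - H x $ i $ j = 0"
    by (simp add: AE_all_countable)
  then show ?thesis by eventually_elim (simp add: vec_eq_iff)
qed

text \<open>The Jacobian matrix: \<open>gradient_matrix w x $ i $ j\<close> is the partial derivative of component \<open>i\<close> in
  direction \<open>j\<close>, the index convention of weak gradients. The limit of difference quotients is used in place of
  the derivative because it is measurable for every continuous \<open>w\<close>; where the limit does not exist, the value
  is arbitrary.\<close>

definition gradient_matrix :: "(real^'n \<Rightarrow> real^'n) \<Rightarrow> real^'n \<Rightarrow> real^'n^'n" where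
  "gradient_matrix w x = (\<chi> i j. lim (\<lambda>k. diff_quot (1 / real (Suc k)) (axis j 1) (\<lambda>y. w y $ i) x))"

lemma gradient_matrix_eq:
  assumes "GDERIV (\<lambda>y. w y $ i) x :> D"
  shows "gradient_matrix w x $ i = D"
proof -
  have "lim (\<lambda>k. diff_quot (1 / real (Suc k)) (axis j 1) (\<lambda>y. w y $ i) x) = D $ j" for j
  proof (rule limI)
    have "(\<lambda>k. diff_quot (1 / real (Suc k)) (axis j 1) (\<lambda>y. w y $ i) x) \<longlonglongrightarrow> axis j 1 \<bullet> D"
      by (intro diff_quot_tendsto[OF assms] LIMSEQ_Suc lim_1_over_n) simp
    then show "(\<lambda>k. diff_quot (1 / real (Suc k)) (axis j 1) (\<lambda>y. w y $ i) x) \<longlonglongrightarrow> D $ j"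
      by (simp add: inner_axis')
  qed
  then show ?thesis by (simp add: gradient_matrix_def vec_eq_iff)
qed

lemma gradient_matrix_measurable:
  assumes "continuous_on UNIV w"
  shows "gradient_matrix w \<in> borel_measurable lebesgue"
proof (rule measurable_matrix_if_components)
  have "continuous_on UNIV (\<lambda>y. w y $ i)" for i by (intro continuous_on_component assms)
  then show "(\<lambda>x. gradient_matrix w x $ i $ j) \<in> borel_measurable lebesgue" for i j
    unfolding gradient_matrix_def vec_lambda_beta
    by (intro borel_measurable_lim_metric lebesgue_measurable_continuous continuous_on_diff_quot)
qed


section \<open>Piecewise affine fields and the finite element space\<close>

lemma norm_matrix_vector_le: "norm ((A :: real^'n^'m) *v x) \<le> norm A * norm x"
proof (rule power2_le_imp_le)
  have "(norm (A *v x))\<^sup>2 = (\<Sum>i\<in>UNIV. (A $ i \<bullet> x)\<^sup>2)"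
    unfolding power2_norm_eq_inner
    by (simp add: inner_vec_def[of "A *v x"] matrix_vector_mul_component power2_eq_square)
  also have "\<dots> \<le> (\<Sum>i\<in>UNIV. (A $ i \<bullet> A $ i) * (x \<bullet> x))"
    by (intro sum_mono Cauchy_Schwarz_ineq)
  also have "\<dots> = (norm A * norm x)\<^sup>2"
    unfolding power_mult_distrib power2_norm_eq_inner
    by (simp add: inner_vec_def[of A] sum_distrib_right)
  finally show "(norm (A *v x))\<^sup>2 \<le> (norm A * norm x)\<^sup>2" .
qed simp

text \<open>The properties of finite element fields used below: continuity on the whole space, zero values outside
  \<open>\<Omega>\<close> and outside the mesh, and an affine expression on every simplex.\<close>

definition pw_affine_field :: "(real^'n) set \<Rightarrow> (real^'n) set set \<Rightarrow> (real^'n \<Rightarrow> real^'n) \<Rightarrow> bool" where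
  "pw_affine_field \<Omega> \<T> w \<longleftrightarrow>
     continuous_on UNIV w \<and> (\<forall>x. x \<notin> \<Omega> \<longrightarrow> w x = 0) \<and> (\<forall>x. x \<notin> \<Union>\<T> \<longrightarrow> w x = 0) \<and>
     (\<forall>S\<in>\<T>. \<exists>A b. \<forall>x\<in>S. w x = A *v x + b)"

lemma pw_affine_fieldE:
  assumes "pw_affine_field \<Omega> \<T> w" "S \<in> \<T>"
  obtains A b where "\<And>x. x \<in> S \<Longrightarrow> w x = A *v x + b"
proof -
  have "\<exists>A b. \<forall>x\<in>S. w x = A *v x + b" using assms by (simp add: pw_affine_field_def)
  then obtain A b where "\<forall>x\<in>S. w x = A *v x + b" by (elim exE)
  then show thesis by (intro that[of A b]) (rule bspec)
qed

lemma pw_affine_field_0: "pw_affine_field \<Omega> \<T> (\<lambda>x. 0)"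
  unfolding pw_affine_field_def
  by (auto intro!: exI[of _ 0] continuous_on_const)

lemma pw_affine_field_add:
  assumes v: "pw_affine_field \<Omega> \<T> v" and w: "pw_affine_field \<Omega> \<T> w"
  shows "pw_affine_field \<Omega> \<T> (\<lambda>x. v x + w x)"
proof -
  have "\<exists>A b. \<forall>x\<in>S. v x + w x = A *v x + b" if S: "S \<in> \<T>" for S
  proof -
    obtain A b where "\<And>x. x \<in> S \<Longrightarrow> v x = A *v x + b" using pw_affine_fieldE[OF v S] by blast
    moreover obtain B c where "\<And>x. x \<in> S \<Longrightarrow> w x = B *v x + c" using pw_affine_fieldE[OF w S] by blast
    ultimately show ?thesis
      by (intro exI[of _ "A + B"] exI[of _ "b + c"]) (simp add: matrix_vector_mult_add_rdistrib)
  qed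
  then show ?thesis
    using v w by (simp add: pw_affine_field_def continuous_on_add)
qed

lemma pw_affine_field_scaleR:
  assumes w: "pw_affine_field \<Omega> \<T> w"
  shows "pw_affine_field \<Omega> \<T> (\<lambda>x. c *\<^sub>R w x)"
proof -
  have "\<exists>A b. \<forall>x\<in>S. c *\<^sub>R w x = A *v x + b" if S: "S \<in> \<T>" for S
  proof -
    obtain A b where "\<And>x. x \<in> S \<Longrightarrow> w x = A *v x + b" using pw_affine_fieldE[OF w S] by blast
    then show ?thesis
      by (intro exI[of _ "c *\<^sub>R A"] exI[of _ "c *\<^sub>R b"]) (simp add: scaleR_matrix_vector_assoc scaleR_add_right)
  qed
  then show ?thesis
    using w by (simp add: pw_affine_field_def continuous_on_scaleR continuous_on_const)
qed

lemma pw_affine_field_sum: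
  assumes "finite B" "\<And>b. b \<in> B \<Longrightarrow> pw_affine_field \<Omega> \<T> (f b)"
  shows "pw_affine_field \<Omega> \<T> (\<lambda>x. \<Sum>b\<in>B. f b x)"
  using assms
proof (induction B)
  case empty
  show ?case by (simp add: pw_affine_field_0)
next
  case (insert b B)
  have "pw_affine_field \<Omega> \<T> (\<lambda>x. f b x + (\<Sum>b\<in>B. f b x))"
    by (intro pw_affine_field_add insert.IH insert.prems) auto
  then show ?case using insert.hyps by simp
qed

text \<open>A hat function is continuous on \<open>closure \<Omega>\<close> and vanishes on the frontier and outside the mesh, hence
  on the complement of the open set \<open>\<Omega>\<close>; the two closed sets \<open>closure \<Omega>\<close> and \<open>- \<Omega>\<close> cover the space.\<close>

lemma pw_affine_field_lagrange:
  fixes \<Omega> :: "(real^'n) set"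
  assumes "open \<Omega>" and mesh: "mesh_of \<Omega> \<T>" and \<psi>: "lagrange_function \<Omega> \<T> p \<psi>" and bd: "\<forall>x\<in>frontier \<Omega>. \<psi> x = 0"
  shows "pw_affine_field \<Omega> \<T> (\<lambda>x. \<psi> x *\<^sub>R axis i 1)"
proof -
  have outT: "\<psi> x = 0" if "x \<notin> \<Union>\<T>" for x
    using \<psi> that by (simp add: lagrange_function_def)
  have out: "\<psi> x = 0" if "x \<notin> \<Omega>" for x
  proof (cases "x \<in> closure \<Omega>")
    case True
    then have "x \<in> frontier \<Omega>" using that \<open>open \<Omega>\<close> by (simp add: frontier_def interior_open)
    then show ?thesis using bd by blast
  next
    case False
    then have "x \<notin> \<Union>\<T>" using mesh by (auto simp: mesh_of_def)
    then show ?thesis by (rule outT)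
  qed
  have "continuous_on (closure \<Omega> \<union> - \<Omega>) \<psi>"
  proof (rule continuous_on_closed_Un)
    show "continuous_on (closure \<Omega>) \<psi>" using \<psi> by (simp add: lagrange_function_def)
    have "continuous_on (- \<Omega>) \<psi> \<longleftrightarrow> continuous_on (- \<Omega>) (\<lambda>x. 0 :: real)"
      by (rule continuous_on_cong) (auto simp: out)
    then show "continuous_on (- \<Omega>) \<psi>" by (simp add: continuous_on_const)
  qed (use \<open>open \<Omega>\<close> in auto)
  moreover have "closure \<Omega> \<union> - \<Omega> = UNIV" using closure_subset[of \<Omega>] by blast
  ultimately have cont: "continuous_on UNIV \<psi>" by simp
  have "\<exists>A b. \<forall>x\<in>S. \<psi> x *\<^sub>R axis i 1 = A *v x + b" if "S \<in> \<T>" for S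
  proof -
    have "\<exists>a b. \<forall>x\<in>S. \<psi> x = a \<bullet> x + b"
      using \<psi> that by (simp add: lagrange_function_def)
    then obtain a b where ab: "\<forall>x\<in>S. \<psi> x = a \<bullet> x + b" by (elim exE)
    define A :: "real^'n^'n" where "A = (\<chi> k. if k = i then a else 0)"
    have "A *v x = (a \<bullet> x) *\<^sub>R axis i 1" for x
      by (simp add: vec_eq_iff matrix_vector_mul_component A_def axis_def)
    with ab have "\<forall>x\<in>S. \<psi> x *\<^sub>R axis i 1 = A *v x + b *\<^sub>R axis i 1" by (simp add: scaleR_add_left)
    then show ?thesis by (intro exI[of _ A] exI[of _ "b *\<^sub>R axis i 1"])
  qed
  then show ?thesis
    unfolding pw_affine_field_def
    using out outT cont by (simp add: continuous_on_scaleR continuous_on_const)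
qed

lemma fe_space_pw_affine_field:
  assumes "open \<Omega>" "mesh_of \<Omega> \<T>" "w \<in> fe_space \<Omega> \<T>"
  shows "pw_affine_field \<Omega> \<T> w"
proof -
  obtain B c where B: "finite B" "B \<subseteq> fe_basis \<Omega> \<T>" and w: "w = (\<lambda>x. \<Sum>b\<in>B. c b *\<^sub>R b x)"
    using assms(3) unfolding fe_space_def by blast
  have "pw_affine_field \<Omega> \<T> b" if "b \<in> B" for b
  proof -
    have "b \<in> fe_basis \<Omega> \<T>" using that B(2) by blast
    then obtain \<psi> i p where b: "b = (\<lambda>x. \<psi> x *\<^sub>R axis i 1)" "lagrange_function \<Omega> \<T> p \<psi>" "\<forall>x\<in>frontier \<Omega>. \<psi> x = 0"
      unfolding fe_basis_def by blast
    show ?thesis unfolding b(1) by (rule pw_affine_field_lagrange[OF assms(1,2) b(2,3)])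
  qed
  then show ?thesis
    unfolding w by (intro pw_affine_field_sum pw_affine_field_scaleR B(1))
qed

lemma fe_space_diff:
  assumes "u \<in> fe_space \<Omega> \<T>" "v \<in> fe_space \<Omega> \<T>"
  shows "(\<lambda>x. u x - v x) \<in> fe_space \<Omega> \<T>"
proof -
  obtain B c where B: "finite B" "B \<subseteq> fe_basis \<Omega> \<T>" and u: "u = (\<lambda>x. \<Sum>b\<in>B. c b *\<^sub>R b x)"
    using assms(1) unfolding fe_space_def by blast
  obtain D d where D: "finite D" "D \<subseteq> fe_basis \<Omega> \<T>" and v: "v = (\<lambda>x. \<Sum>b\<in>D. d b *\<^sub>R b x)"
    using assms(2) unfolding fe_space_def by blast
  \<comment> \<open>The two families of basis fields may overlap; coefficients are extended by zero to their union.\<close>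
  define k where "k = (\<lambda>b. (if b \<in> B then c b else 0) - (if b \<in> D then d b else 0))"
  have "u x - v x = (\<Sum>b\<in>B \<union> D. k b *\<^sub>R b x)" for x
  proof -
    have "u x = (\<Sum>b\<in>B \<union> D. (if b \<in> B then c b else 0) *\<^sub>R b x)"
      unfolding u by (rule sum.mono_neutral_cong_left) (use B D in auto)
    moreover have "v x = (\<Sum>b\<in>B \<union> D. (if b \<in> D then d b else 0) *\<^sub>R b x)"
      unfolding v by (rule sum.mono_neutral_cong_left) (use B D in auto)
    ultimately show ?thesis by (simp add: k_def scaleR_diff_left sum_subtractf)
  qed
  then have "(\<lambda>x. u x - v x) = (\<lambda>x. \<Sum>b\<in>B \<union> D. k b *\<^sub>R b x)" by (rule ext)
  moreover have "finite (B \<union> D)" "B \<union> D \<subseteq> fe_basis \<Omega> \<T>" using B D by auto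
  ultimately show ?thesis unfolding fe_space_def by blast
qed

lemma mesh_simplex:
  fixes \<Omega> :: "(real^'n) set"
  assumes "mesh_of \<Omega> \<T>" "S \<in> \<T>"
  shows "compact S" "convex S" "interior S \<noteq> {}" "S \<subseteq> closure \<Omega>"
proof -
  have S: "int CARD('n) simplex S" using assms by (simp add: mesh_of_def)
  show "compact S" using S by (rule compact_simplex)
  show "convex S" using S by (rule convex_simplex)
  have aff: "aff_dim S = int CARD('n)" using S by (rule aff_dim_simplex)
  then have "S \<noteq> {}" by auto
  then have "rel_interior S \<noteq> {}" using \<open>convex S\<close> by (simp add: rel_interior_eq_empty)
  then show "interior S \<noteq> {}" using aff by (simp add: interior_rel_interior_gen)
  show "S \<subseteq> closure \<Omega>" using assms by (auto simp: mesh_of_def)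
qed

lemma mesh_finite: "mesh_of \<Omega> \<T> \<Longrightarrow> finite \<T>"
  by (simp add: mesh_of_def triangulation_def)

lemma closed_mesh_Union:
  assumes "mesh_of \<Omega> \<T>"
  shows "closed (\<Union>\<T>)"
  by (intro closed_Union ballI compact_imp_closed mesh_simplex(1)[OF assms] mesh_finite[OF assms])

text \<open>On a segment from \<open>x\<close> to \<open>y\<close> the field is Lipschitz on each of finitely many closed parameter sets that
  cover \<open>[0, 1]\<close>: one for every simplex, and the zero set \<open>Z\<close>, which covers the part outside the mesh. Being
  closed is the reason for taking the zero set instead of the complement of the mesh.\<close>

lemma lipschitz_pw_affine_field:
  fixes \<Omega> :: "(real^'n) set"
  assumes mesh: "mesh_of \<Omega> \<T>" and w: "pw_affine_field \<Omega> \<T> w" and "0 \<le> L"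
    and aff: "\<And>S x. S \<in> \<T> \<Longrightarrow> x \<in> S \<Longrightarrow> w x = A S *v x + b S"
    and L: "\<And>S. S \<in> \<T> \<Longrightarrow> norm (A S) \<le> L"
  shows "L-lipschitz_on UNIV w"
proof (rule lipschitz_onI[OF _ \<open>0 \<le> L\<close>])
  fix x y :: "real^'n"
  define l where "l = (\<lambda>t. x + t *\<^sub>R (y - x))"
  have contl: "continuous_on UNIV l"
    unfolding l_def by (intro continuous_on_add continuous_on_const continuous_on_scaleR continuous_on_id)
  have contw: "continuous_on UNIV w" using w by (simp add: pw_affine_field_def)
  have contg: "continuous_on UNIV (\<lambda>t. w (l t))"
    by (rule continuous_on_compose2[OF contw contl]) simp
  define Z where "Z = {t. w (l t) = 0}"
  have "closed Z"
    unfolding Z_def by (intro closed_Collect_eq contg continuous_on_const)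
  have "(L * norm (y - x))-lipschitz_on {0..1} (\<lambda>t. w (l t))"
  proof (rule lipschitz_on_closed_Union[where I = "insert Z ((\<lambda>S. l -` S) ` \<T>)" and U = "\<lambda>V. V"])
    fix V assume V: "V \<in> insert Z ((\<lambda>S. l -` S) ` \<T>)"
    show "(L * norm (y - x))-lipschitz_on V (\<lambda>t. w (l t))"
    proof (cases "V = Z")
      case True
      then show ?thesis
        using \<open>0 \<le> L\<close> by (intro lipschitz_onI) (auto simp: Z_def)
    next
      case False
      then obtain S where S: "S \<in> \<T>" "V = l -` S" using V by auto
      show ?thesis
      proof (rule lipschitz_onI)
        fix s t assume "s \<in> V" "t \<in> V"
        then have "w (l s) - w (l t) = A S *v (l s - l t)"
          using aff[OF S(1)] S(2) by (simp add: matrix_vector_mult_diff_distrib)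
        also have "l s - l t = (s - t) *\<^sub>R (y - x)" by (simp add: l_def scaleR_diff_left)
        finally have "norm (w (l s) - w (l t)) \<le> norm (A S) * norm ((s - t) *\<^sub>R (y - x))"
          by (simp only: norm_matrix_vector_le)
        also have "\<dots> \<le> L * norm ((s - t) *\<^sub>R (y - x))"
          by (intro mult_right_mono L S) simp
        finally show "dist (w (l s)) (w (l t)) \<le> L * norm (y - x) * dist s t"
          by (simp add: dist_norm mult_ac)
      qed (use \<open>0 \<le> L\<close> in simp)
    qed
    show "closed V"
      using V
    proof
      assume "V = Z" then show ?thesis using \<open>closed Z\<close> by simp
    next
      assume "V \<in> (\<lambda>S. l -` S) ` \<T>"
      then obtain S where S: "S \<in> \<T>" "V = l -` S" by auto
      have "closed S" using mesh_simplex(1)[OF mesh S(1)] by (rule compact_imp_closed)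
      then show ?thesis unfolding S(2) using contl by (rule closed_vimage)
    qed
  next
    show "finite (insert Z ((\<lambda>S. l -` S) ` \<T>))" using mesh_finite[OF mesh] by simp
    show "0 \<le> L * norm (y - x)" using \<open>0 \<le> L\<close> by simp
    show "{0..1} \<subseteq> (\<Union>V\<in>insert Z ((\<lambda>S. l -` S) ` \<T>). V)"
    proof
      fix t :: real
      show "t \<in> (\<Union>V\<in>insert Z ((\<lambda>S. l -` S) ` \<T>). V)"
      proof (cases "l t \<in> \<Union>\<T>")
        case False
        then have "t \<in> Z" using w by (simp add: Z_def pw_affine_field_def)
        then show ?thesis by blast
      qed auto
    qed
  qed
  from lipschitz_onD[OF this, of 0 1] show "dist (w x) (w y) \<le> L * dist x y"
    by (simp add: l_def dist_norm norm_minus_commute)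
qed

section \<open>Weak gradients and Korn's inequality for piecewise affine fields\<close>

lemma pw_affine_field_coefficients:
  assumes "pw_affine_field \<Omega> \<T> w"
  shows "\<exists>A b. \<forall>S\<in>\<T>. \<forall>x\<in>S. w x = A S *v x + b S"
proof -
  have "\<forall>S. \<exists>Ab. S \<in> \<T> \<longrightarrow> (\<forall>x\<in>S. w x = fst Ab *v x + snd Ab)"
    using pw_affine_fieldE[OF assms] by (metis fst_conv snd_conv)
  then obtain f where "\<forall>S. S \<in> \<T> \<longrightarrow> (\<forall>x\<in>S. w x = fst (f S) *v x + snd (f S))"
    by (rule choice[THEN exE])
  then show ?thesis by (intro exI[of _ "\<lambda>S. fst (f S)"] exI[of _ "\<lambda>S. snd (f S)"]) blast
qed

lemma GDERIV_affine_on_interior: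
  fixes w :: "real^'n \<Rightarrow> real^'n"
  assumes "x \<in> interior S" and w: "\<And>y. y \<in> S \<Longrightarrow> w y = A *v y + b"
  shows "GDERIV (\<lambda>y. w y $ i) x :> A $ i"
  unfolding gderiv_def
proof (rule has_derivative_transform_within_open[OF _ open_interior assms(1)])
  show "((\<lambda>y. A $ i \<bullet> y + b $ i) has_derivative (\<lambda>h. h \<bullet> A $ i)) (at x)"
    by (rule has_derivative_eq_rhs, (rule derivative_intros)+) (simp add: fun_eq_iff inner_commute)
  show "A $ i \<bullet> y + b $ i = w y $ i" if "y \<in> interior S" for y
    using w[of y] that interior_subset[of S] by (auto simp: matrix_vector_mul_component)
qed

lemma gradient_matrix_on_interior:
  fixes w :: "real^'n \<Rightarrow> real^'n"
  assumes "x \<in> interior S" and "\<And>y. y \<in> S \<Longrightarrow> w y = A *v y + b"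
  shows "gradient_matrix w x = A"
  using gradient_matrix_eq[OF GDERIV_affine_on_interior[OF assms]] by (simp add: vec_eq_iff)

text \<open>A simplex may contain a part of the frontier of \<open>\<Omega>\<close> of positive measure. There the field is zero, and an
  affine function with nonzero linear part vanishes at most on a hyperplane; hence the gradient is zero almost
  everywhere outside \<open>\<Omega>\<close>.\<close>

lemma AE_GDERIV_pw_affine_field:
  fixes \<Omega> :: "(real^'n) set"
  assumes mesh: "mesh_of \<Omega> \<T>" and w: "pw_affine_field \<Omega> \<T> w"
  shows "AE x in lebesgue. (\<forall>i. GDERIV (\<lambda>y. w y $ i) x :> gradient_matrix w x $ i)
           \<and> (x \<notin> \<Omega> \<longrightarrow> gradient_matrix w x = 0)"
proof -
  obtain A b where "\<forall>S\<in>\<T>. \<forall>x\<in>S. w x = A S *v x + b S"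
    using pw_affine_field_coefficients[OF w] by blast
  then have aff: "w x = A S *v x + b S" if "S \<in> \<T>" "x \<in> S" for S x
    using that by blast
  have "AE x in lebesgue. \<forall>S\<in>\<T>. x \<notin> frontier S"
  proof (rule AE_finite_allI[OF mesh_finite[OF mesh]])
    fix S assume S: "S \<in> \<T>"
    have "negligible (frontier S)"
      by (rule negligible_convex_frontier[OF mesh_simplex(2)[OF mesh S]])
    then show "AE x in lebesgue. x \<notin> frontier S"
      unfolding negligible_iff_null_sets by (rule AE_not_in)
  qed
  moreover have "AE x in lebesgue. \<forall>S\<in>\<T>. \<forall>i. A S $ i \<noteq> 0 \<longrightarrow> A S $ i \<bullet> x \<noteq> - (b S $ i)"
  proof (rule AE_finite_allI[OF mesh_finite[OF mesh]])
    fix S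
    have "AE x in lebesgue. A S $ i \<noteq> 0 \<longrightarrow> A S $ i \<bullet> x \<noteq> - (b S $ i)" for i
    proof (cases "A S $ i = 0")
      case False
      then have "negligible {x. A S $ i \<bullet> x = - (b S $ i)}"
        by (intro negligible_hyperplane) simp
      then have "AE x in lebesgue. x \<notin> {x. A S $ i \<bullet> x = - (b S $ i)}"
        unfolding negligible_iff_null_sets by (rule AE_not_in)
      then show ?thesis by simp
    qed simp
    then show "AE x in lebesgue. \<forall>i. A S $ i \<noteq> 0 \<longrightarrow> A S $ i \<bullet> x \<noteq> - (b S $ i)"
      by (simp only: AE_all_countable) blast
  qed
  ultimately show ?thesis
  proof eventually_elim
    case (elim x)
    show ?case
    proof (cases "x \<in> \<Union>\<T>")
      case True
      then obtain S where S: "S \<in> \<T>" "x \<in> S" by blast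
      have "closed S" using mesh_simplex(1)[OF mesh S(1)] by (rule compact_imp_closed)
      then have int: "x \<in> interior S"
        using elim(1) S by (auto simp: frontier_def)
      have D: "GDERIV (\<lambda>y. w y $ i) x :> A S $ i" for i
        by (rule GDERIV_affine_on_interior[OF int aff[OF S(1)]])
      have G: "gradient_matrix w x = A S"
        by (rule gradient_matrix_on_interior[OF int aff[OF S(1)]])
      have "A S = 0" if "x \<notin> \<Omega>"
      proof -
        have "w x = 0" using that w by (simp add: pw_affine_field_def)
        then have "A S *v x + b S = 0" using aff[OF S] by simp
        then have "(A S *v x + b S) $ i = 0" for i by simp
        then have "A S $ i \<bullet> x = - (b S $ i)" for i
          by (simp add: matrix_vector_mul_component add_eq_0_iff2)
        then have "A S $ i = 0" for i using elim(2) S(1) by blast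
        then show ?thesis by (simp add: vec_eq_iff)
      qed
      then show ?thesis using D G by simp
    next
      case False
      have D: "GDERIV (\<lambda>y. w y $ i) x :> 0" for i
        unfolding gderiv_def
      proof (rule has_derivative_transform_within_open[of "\<lambda>_. 0" _ _ _ "- \<Union>\<T>"])
        show "open (- \<Union>\<T>)" using closed_mesh_Union[OF mesh] by (rule open_Compl)
        show "x \<in> - \<Union>\<T>" using False by blast
        show "0 = w y $ i" if "y \<in> - \<Union>\<T>" for y
          using that w by (simp add: pw_affine_field_def)
      qed simp
      have "gradient_matrix w x $ i = 0" for i by (rule gradient_matrix_eq[OF D])
      then have "gradient_matrix w x = 0" by (simp add: vec_eq_iff)
      then show ?thesis using D by simp
    qed
  qed
qed

lemma ae_gradient_pw_affine_field:
  fixes \<Omega> :: "(real^'n) set"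
  assumes "bounded \<Omega>" and mesh: "mesh_of \<Omega> \<T>" and w: "pw_affine_field \<Omega> \<T> w"
  shows "ae_gradient (\<lambda>x. w x $ i) (\<lambda>x. gradient_matrix w x $ i)"
proof -
  obtain A b where "\<forall>S\<in>\<T>. \<forall>x\<in>S. w x = A S *v x + b S"
    using pw_affine_field_coefficients[OF w] by blast
  then have aff: "w x = A S *v x + b S" if "S \<in> \<T>" "x \<in> S" for S x
    using that by blast
  \<comment> \<open>A crude Lipschitz constant; only its existence matters here.\<close>
  define L where "L = (\<Sum>S\<in>\<T>. norm (A S))"
  have "L-lipschitz_on UNIV w"
  proof (rule lipschitz_pw_affine_field[OF mesh w _ aff])
    show "norm (A S) \<le> L" if "S \<in> \<T>" for S
      unfolding L_def using mesh_finite[OF mesh] that by (intro member_le_sum) auto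
    show "0 \<le> L" unfolding L_def by (intro sum_nonneg) simp
  qed
  then have "L-lipschitz_on UNIV (\<lambda>x. w x $ i)"
    unfolding lipschitz_on_def by (meson dist_vec_nth_le order_trans)
  moreover have "bounded {x. w x $ i \<noteq> 0}"
  proof (rule bounded_subset[OF \<open>bounded \<Omega>\<close>], rule subsetI)
    fix x assume "x \<in> {x. w x $ i \<noteq> 0}"
    then have "w x \<noteq> 0" by auto
    then show "x \<in> \<Omega>" using w by (auto simp: pw_affine_field_def)
  qed
  moreover have "(\<lambda>x. gradient_matrix w x $ i) \<in> borel_measurable lebesgue"
  proof -
    have "gradient_matrix w \<in> borel_measurable lebesgue"
      using w by (intro gradient_matrix_measurable) (simp add: pw_affine_field_def)
    then show ?thesis
      by (rule measurable_compose) (intro borel_measurable_continuous_onI continuous_on_component continuous_on_id)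
  qed
  moreover have "AE x in lebesgue. GDERIV (\<lambda>y. w y $ i) x :> gradient_matrix w x $ i"
    using AE_GDERIV_pw_affine_field[OF mesh w] by eventually_elim simp
  ultimately show ?thesis unfolding ae_gradient_def by blast
qed

lemma integral_lebesgue_on_eq:
  fixes h :: "real^'n \<Rightarrow> real"
  assumes "\<Omega> \<in> sets lebesgue" "h \<in> borel_measurable lebesgue" "AE x in lebesgue. x \<notin> \<Omega> \<longrightarrow> h x = 0"
  shows "(LINT x|lebesgue_on \<Omega>. h x) = (LINT x|lebesgue. h x)"
proof -
  have "(LINT x|lebesgue_on \<Omega>. h x) = (LINT x|lebesgue. indicator \<Omega> x *\<^sub>R h x)"
    using assms(1) by (intro integral_restrict_space) simp
  also have "\<dots> = (LINT x|lebesgue. h x)"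
  proof (rule integral_cong_AE)
    show "(\<lambda>x. indicator \<Omega> x *\<^sub>R h x) \<in> borel_measurable lebesgue"
      using assms by (intro borel_measurable_scaleR borel_measurable_indicator)
    show "AE x in lebesgue. indicator \<Omega> x *\<^sub>R h x = h x"
      using assms(3) by eventually_elim (auto simp: indicator_def)
  qed (rule assms)
  finally show ?thesis .
qed

lemma integrable_lebesgue_on:
  fixes h :: "real^'n \<Rightarrow> real"
  assumes "\<Omega> \<in> sets lebesgue" "integrable lebesgue h"
  shows "integrable (lebesgue_on \<Omega>) h"
  using assms integrable_mult_indicator[OF assms] by (subst integrable_restrict_space) auto

lemma integrable_gradient_matrix_mult:
  fixes \<Omega> :: "(real^'n) set"
  assumes "bounded \<Omega>" "mesh_of \<Omega> \<T>" "pw_affine_field \<Omega> \<T> v" "pw_affine_field \<Omega> \<T> w"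
  shows "integrable lebesgue (\<lambda>x. gradient_matrix v x $ i $ j * gradient_matrix w x $ k $ l)"
  using integrable_gradient_mult[OF ae_gradient_pw_affine_field[OF assms(1-3), of i]
      ae_gradient_pw_affine_field[OF assms(1,2,4), of k], of "axis j 1" "axis l 1"]
  by (simp add: inner_axis')

lemma has_weak_gradient_pw_affine_field:
  fixes \<Omega> :: "(real^'n) set"
  assumes "open \<Omega>" "bounded \<Omega>" and mesh: "mesh_of \<Omega> \<T>" and w: "pw_affine_field \<Omega> \<T> w"
  shows "has_weak_gradient \<Omega> w (gradient_matrix w)"
proof -
  have \<Omega>: "\<Omega> \<in> sets lebesgue" using \<open>open \<Omega>\<close> by simp
  have cw: "continuous_on UNIV w" using w by (simp add: pw_affine_field_def)
  have "square_integrable_field \<Omega> w"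
    unfolding square_integrable_field_def
  proof
    show "w \<in> borel_measurable (lebesgue_on \<Omega>)"
      by (intro measurable_restrict_space1 lebesgue_measurable_continuous cw)
    show "integrable (lebesgue_on \<Omega>) (\<lambda>x. (norm (w x))\<^sup>2)"
    proof (intro integrable_lebesgue_on \<Omega> integrable_continuous_bounded_support)
      show "continuous_on UNIV (\<lambda>x. (norm (w x))\<^sup>2)"
        by (intro continuous_on_power continuous_on_norm cw)
      show "bounded {x. (norm (w x))\<^sup>2 \<noteq> 0}"
        by (rule bounded_subset[OF \<open>bounded \<Omega>\<close>]) (use w in \<open>auto simp: pw_affine_field_def\<close>)
    qed
  qed
  moreover have "square_integrable_field \<Omega> (gradient_matrix w)"
    unfolding square_integrable_field_def
  proof
    show "gradient_matrix w \<in> borel_measurable (lebesgue_on \<Omega>)"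
      by (intro measurable_restrict_space1 gradient_matrix_measurable cw)
    show "integrable (lebesgue_on \<Omega>) (\<lambda>x. (norm (gradient_matrix w x))\<^sup>2)"
      unfolding norm_matrix_power2 unfolding power2_eq_square
      by (intro integrable_lebesgue_on \<Omega> Bochner_Integration.integrable_sum
          integrable_gradient_matrix_mult[OF \<open>bounded \<Omega>\<close> mesh w w])
  qed
  moreover have "(LINT x|lebesgue_on \<Omega>. w x $ i * \<phi>' x $ j) = - (LINT x|lebesgue_on \<Omega>. gradient_matrix w x $ i $ j * \<phi> x)"
    if \<phi>: "test_function \<Omega> \<phi> \<phi>'" for \<phi> \<phi>' i j
  proof -
    note gw = ae_gradient_pw_affine_field[OF \<open>bounded \<Omega>\<close> mesh w, of i]
    note g\<phi> = test_function_ae_gradient[OF \<phi>]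
    have c: "continuous_on UNIV \<phi>" by (rule ae_gradient_continuous[OF g\<phi>])
    have c': "continuous_on UNIV \<phi>'" using \<phi> by (simp add: test_function_def)
    have "(LINT x|lebesgue_on \<Omega>. w x $ i * \<phi>' x $ j) = (LINT x|lebesgue. w x $ i * \<phi>' x $ j)"
    proof (rule integral_lebesgue_on_eq[OF \<Omega>])
      show "(\<lambda>x. w x $ i * \<phi>' x $ j) \<in> borel_measurable lebesgue"
        by (intro lebesgue_measurable_continuous continuous_on_mult continuous_on_component cw c')
      show "AE x in lebesgue. x \<notin> \<Omega> \<longrightarrow> w x $ i * \<phi>' x $ j = 0"
        using w by (intro AE_I2) (auto simp: pw_affine_field_def)
    qed
    also have "\<dots> = - (LINT x|lebesgue. gradient_matrix w x $ i $ j * \<phi> x)"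
      using integral_gradient_by_parts[OF gw g\<phi>, of "axis j 1"] by (simp add: inner_axis')
    also have "(LINT x|lebesgue. gradient_matrix w x $ i $ j * \<phi> x) = (LINT x|lebesgue_on \<Omega>. gradient_matrix w x $ i $ j * \<phi> x)"
    proof (rule integral_lebesgue_on_eq[OF \<Omega>, symmetric])
      show "(\<lambda>x. gradient_matrix w x $ i $ j * \<phi> x) \<in> borel_measurable lebesgue"
        by (intro borel_measurable_times component2_measurable gradient_matrix_measurable cw
            lebesgue_measurable_continuous c)
      show "AE x in lebesgue. x \<notin> \<Omega> \<longrightarrow> gradient_matrix w x $ i $ j * \<phi> x = 0"
        using \<phi> by (intro AE_I2) (auto simp: test_function_def)
    qed
    finally show ?thesis .
  qed
  ultimately show ?thesis unfolding has_weak_gradient_def by blast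
qed

lemma has_weak_gradient_weak_gradient:
  assumes "has_weak_gradient \<Omega> u G"
  shows "has_weak_gradient \<Omega> u (weak_gradient \<Omega> u)"
  unfolding weak_gradient_def by (rule someI[of "has_weak_gradient \<Omega> u", OF assms])

lemma AE_weak_gradient_pw_affine_field:
  fixes \<Omega> :: "(real^'n) set"
  assumes "open \<Omega>" "bounded \<Omega>" "mesh_of \<Omega> \<T>" "pw_affine_field \<Omega> \<T> w"
  shows "AE x in lebesgue_on \<Omega>. weak_gradient \<Omega> w x = gradient_matrix w x"
  using has_weak_gradient_pw_affine_field[OF assms]
  by (rule AE_weak_gradient_unique[OF assms(1,2) has_weak_gradient_weak_gradient])
    (rule has_weak_gradient_pw_affine_field[OF assms])

text \<open>Korn's first inequality with its constant \<open>2\<close>. Expanding the square of the symmetric part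
  leaves the mixed term \<open>\<Sum>\<^sub>i\<^sub>j G\<^sub>i\<^sub>j G\<^sub>j\<^sub>i\<close>, whose integral is that of the squared divergence.\<close>

lemma korn_inequality_pw_affine_field:
  fixes \<Omega> :: "(real^'n) set"
  assumes "open \<Omega>" "bounded \<Omega>" and mesh: "mesh_of \<Omega> \<T>" and w: "pw_affine_field \<Omega> \<T> w"
  defines "G \<equiv> gradient_matrix w"
  shows "(LINT x|lebesgue_on \<Omega>. (norm (G x))\<^sup>2)
      \<le> 2 * (LINT x|lebesgue_on \<Omega>. (norm ((1/2) *\<^sub>R (G x + transpose (G x))))\<^sup>2)"
proof -
  have \<Omega>: "\<Omega> \<in> sets lebesgue" using \<open>open \<Omega>\<close> by simp
  have int: "integrable lebesgue (\<lambda>x. G x $ i $ j * G x $ k $ l)" for i j k l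
    unfolding G_def by (rule integrable_gradient_matrix_mult[OF \<open>bounded \<Omega>\<close> mesh w w])
  have int': "integrable (lebesgue_on \<Omega>) (\<lambda>x. G x $ i $ j * G x $ k $ l)" for i j k l
    by (intro integrable_lebesgue_on \<Omega> int)
  have out: "AE x in lebesgue. x \<notin> \<Omega> \<longrightarrow> G x $ i $ j * G x $ k $ l = 0" for i j k l
    using AE_GDERIV_pw_affine_field[OF mesh w] by eventually_elim (simp add: G_def)
  have on: "(LINT x|lebesgue_on \<Omega>. G x $ i $ j * G x $ k $ l) = (LINT x|lebesgue. G x $ i $ j * G x $ k $ l)" for i j k l
    by (intro integral_lebesgue_on_eq \<Omega> out borel_measurable_integrable int)
  have swap: "(LINT x|lebesgue_on \<Omega>. G x $ i $ j * G x $ j $ i) = (LINT x|lebesgue_on \<Omega>. G x $ i $ i * G x $ j $ j)" for i j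
    using integral_gradient_swap[OF ae_gradient_pw_affine_field[OF \<open>bounded \<Omega>\<close> mesh w, of i]
        ae_gradient_pw_affine_field[OF \<open>bounded \<Omega>\<close> mesh w, of j], of "axis j 1" "axis i 1"]
    unfolding on by (simp add: inner_axis' G_def)
  have "0 \<le> (LINT x|lebesgue_on \<Omega>. (\<Sum>i\<in>UNIV. G x $ i $ i)\<^sup>2)" by simp
  also have "\<dots> = (LINT x|lebesgue_on \<Omega>. (\<Sum>i\<in>UNIV. \<Sum>j\<in>UNIV. G x $ i $ i * G x $ j $ j))"
    by (simp add: power2_eq_square sum_product)
  also have "\<dots> = (\<Sum>i\<in>UNIV. \<Sum>j\<in>UNIV. LINT x|lebesgue_on \<Omega>. G x $ i $ i * G x $ j $ j)"
    using int' by simp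
  also have "\<dots> = (\<Sum>i\<in>UNIV. \<Sum>j\<in>UNIV. LINT x|lebesgue_on \<Omega>. G x $ i $ j * G x $ j $ i)"
    by (simp only: swap)
  also have "\<dots> = (LINT x|lebesgue_on \<Omega>. (\<Sum>i\<in>UNIV. \<Sum>j\<in>UNIV. G x $ i $ j * G x $ j $ i))"
    using int' by simp
  finally have pos: "0 \<le> (LINT x|lebesgue_on \<Omega>. (\<Sum>i\<in>UNIV. \<Sum>j\<in>UNIV. G x $ i $ j * G x $ j $ i))" .
  have sym: "2 * (norm ((1/2) *\<^sub>R (M + transpose M)))\<^sup>2
     = (norm M)\<^sup>2 + (\<Sum>i\<in>UNIV. \<Sum>j\<in>UNIV. M $ i $ j * M $ j $ i)" for M :: "real^'n^'n"
  proof -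
    have "2 * (norm ((1/2) *\<^sub>R (M + transpose M)))\<^sup>2 = (\<Sum>i\<in>UNIV. \<Sum>j\<in>UNIV. 2 * (((1/2) *\<^sub>R (M + transpose M)) $ i $ j)\<^sup>2)"
      unfolding norm_matrix_power2 by (simp add: sum_distrib_left)
    also have "\<dots> = (\<Sum>i\<in>UNIV. \<Sum>j\<in>UNIV. (M $ i $ j)\<^sup>2 / 2 + (M $ j $ i)\<^sup>2 / 2 + M $ i $ j * M $ j $ i)"
      by (intro sum.cong refl) (simp add: transpose_def power2_eq_square field_simps)
    also have "\<dots> = (\<Sum>i\<in>UNIV. \<Sum>j\<in>UNIV. (M $ i $ j)\<^sup>2 / 2) + (\<Sum>i\<in>UNIV. \<Sum>j\<in>UNIV. (M $ j $ i)\<^sup>2 / 2)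
         + (\<Sum>i\<in>UNIV. \<Sum>j\<in>UNIV. M $ i $ j * M $ j $ i)"
      by (simp only: sum.distrib)
    also have "(\<Sum>i\<in>UNIV. \<Sum>j\<in>UNIV. (M $ j $ i)\<^sup>2 / 2) = (\<Sum>i\<in>UNIV. \<Sum>j\<in>UNIV. (M $ i $ j)\<^sup>2 / 2)"
      by (rule sum.swap)
    also have "(\<Sum>i\<in>UNIV. \<Sum>j\<in>UNIV. (M $ i $ j)\<^sup>2 / 2) = (norm M)\<^sup>2 / 2"
      unfolding norm_matrix_power2 by (simp add: sum_divide_distrib)
    finally show ?thesis by simp
  qed
  have i1: "integrable (lebesgue_on \<Omega>) (\<lambda>x. (norm (G x))\<^sup>2)"
    unfolding norm_matrix_power2 unfolding power2_eq_square by (intro Bochner_Integration.integrable_sum int')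
  have i2: "integrable (lebesgue_on \<Omega>) (\<lambda>x. \<Sum>i\<in>UNIV. \<Sum>j\<in>UNIV. G x $ i $ j * G x $ j $ i)"
    by (intro Bochner_Integration.integrable_sum int')
  have "2 * (LINT x|lebesgue_on \<Omega>. (norm ((1/2) *\<^sub>R (G x + transpose (G x))))\<^sup>2)
     = (LINT x|lebesgue_on \<Omega>. 2 * (norm ((1/2) *\<^sub>R (G x + transpose (G x))))\<^sup>2)"
    by (rule integral_mult_right_zero[symmetric])
  also have "\<dots> = (LINT x|lebesgue_on \<Omega>. (norm (G x))\<^sup>2)
      + (LINT x|lebesgue_on \<Omega>. (\<Sum>i\<in>UNIV. \<Sum>j\<in>UNIV. G x $ i $ j * G x $ j $ i))"
    unfolding sym by (rule Bochner_Integration.integral_add[OF i1 i2])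
  finally show ?thesis using pos by linarith
qed

text \<open>An inverse estimate. The gradient is constant on the interior of a simplex \<open>S\<close>, so its size there is
  bounded by its $L^2(\Omega)$ norm divided by the square root of the measure of \<open>interior S \<inter> \<Omega>\<close>. This set,
  and not \<open>S\<close> itself, is used because \<open>S\<close> is only contained in the closure of \<open>\<Omega>\<close>.\<close>

lemma inverse_estimate:
  fixes \<Omega> :: "(real^'n) set"
  assumes "open \<Omega>" "bounded \<Omega>" and mesh: "mesh_of \<Omega> \<T>"
  obtains C where "0 < C"
    "\<And>w. pw_affine_field \<Omega> \<T> w \<Longrightarrow>
       (C * sqrt (LINT x|lebesgue_on \<Omega>. (norm (gradient_matrix w x))\<^sup>2))-lipschitz_on UNIV w"
proof -
  have \<Omega>: "\<Omega> \<in> sets lebesgue" using \<open>open \<Omega>\<close> by simp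
  define m where "m = (\<lambda>S. measure lebesgue (interior S \<inter> \<Omega>))"
  have mpos: "0 < m S" if "S \<in> \<T>" for S
  proof -
    have "interior S \<inter> closure \<Omega> \<noteq> {}"
      using mesh_simplex(3,4)[OF mesh that] interior_subset[of S] by blast
    then have "interior S \<inter> \<Omega> \<noteq> {}" by (simp add: open_Int_closure_eq_empty)
    then have "\<not> negligible (interior S \<inter> \<Omega>)"
      using \<open>open \<Omega>\<close> by (intro open_not_negligible) auto
    moreover have "interior S \<inter> \<Omega> \<in> lmeasurable"
      using \<open>open \<Omega>\<close> \<open>bounded \<Omega>\<close> by (intro lmeasurable_open) auto
    ultimately have "m S \<noteq> 0" unfolding m_def by (simp add: negligible_iff_measure)
    moreover have "0 \<le> m S" by (simp add: m_def)
    ultimately show ?thesis by linarith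
  qed
  \<comment> \<open>The summand \<open>1\<close> keeps the constant positive for an empty mesh.\<close>
  define C where "C = 1 + (\<Sum>S\<in>\<T>. 1 / sqrt (m S))"
  have C: "1 / sqrt (m S) \<le> C" if "S \<in> \<T>" for S
  proof -
    have "1 / sqrt (m S) \<le> (\<Sum>S\<in>\<T>. 1 / sqrt (m S))"
      using mesh_finite[OF mesh] that mpos by (intro member_le_sum) (auto intro: less_imp_le)
    then show ?thesis by (simp add: C_def)
  qed
  show thesis
  proof (rule that[of C])
    show "0 < C"
      unfolding C_def using mpos by (intro add_pos_nonneg sum_nonneg) (auto intro: less_imp_le)
    fix w assume w: "pw_affine_field \<Omega> \<T> w"
    obtain A b where "\<forall>S\<in>\<T>. \<forall>x\<in>S. w x = A S *v x + b S"
      using pw_affine_field_coefficients[OF w] by blast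
    then have aff: "w x = A S *v x + b S" if "S \<in> \<T>" "x \<in> S" for S x
      using that by blast
    define I where "I = (LINT x|lebesgue_on \<Omega>. (norm (gradient_matrix w x))\<^sup>2)"
    have iG: "integrable (lebesgue_on \<Omega>) (\<lambda>x. (norm (gradient_matrix w x))\<^sup>2)"
      using has_weak_gradient_pw_affine_field[OF assms w]
      by (simp add: has_weak_gradient_def square_integrable_field_def)
    have fin: "finite_measure (lebesgue_on \<Omega>)"
      by (rule finite_measure_lebesgue_on_bounded[OF assms(1,2)])
    have "norm (A S) \<le> C * sqrt I" if S: "S \<in> \<T>" for S
    proof -
      have mS: "interior S \<inter> \<Omega> \<in> sets (lebesgue_on \<Omega>)"
        using \<Omega> by (auto simp: sets_restrict_space_iff intro!: sets.Int)
      have iS: "integrable (lebesgue_on \<Omega>) (indicat_real (interior S \<inter> \<Omega>))"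
        using mS finite_measure.emeasure_finite[OF fin]
        by (intro integrable_real_indicator) (auto simp: less_top)
      have "(norm (A S))\<^sup>2 * m S = (LINT x|lebesgue_on \<Omega>. (norm (A S))\<^sup>2 * indicat_real (interior S \<inter> \<Omega>) x)"
        using mS \<Omega> by (simp add: m_def measure_restrict_space)
      also have "\<dots> \<le> I"
        unfolding I_def
      proof (rule integral_mono)
        show "integrable (lebesgue_on \<Omega>) (\<lambda>x. (norm (A S))\<^sup>2 * indicat_real (interior S \<inter> \<Omega>) x)"
          using iS by simp
        show "(norm (A S))\<^sup>2 * indicat_real (interior S \<inter> \<Omega>) x \<le> (norm (gradient_matrix w x))\<^sup>2" for x
        proof (cases "x \<in> interior S \<inter> \<Omega>")
          case True
          then have "gradient_matrix w x = A S"
            by (intro gradient_matrix_on_interior[of x S w, OF _ aff[OF S]]) auto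
          then show ?thesis using True by simp
        qed simp
      qed (rule iG)
      finally have "sqrt ((norm (A S))\<^sup>2 * m S) \<le> sqrt I" by (rule real_sqrt_le_mono)
      then have "norm (A S) * sqrt (m S) \<le> sqrt I" by (simp add: real_sqrt_mult)
      then have "norm (A S) \<le> 1 / sqrt (m S) * sqrt I"
        using mpos[OF S] by (simp add: field_simps)
      also have "\<dots> \<le> C * sqrt I"
        by (intro mult_right_mono C S) (simp add: I_def)
      finally show ?thesis .
    qed
    then show "(C * sqrt (LINT x|lebesgue_on \<Omega>. (norm (gradient_matrix w x))\<^sup>2))-lipschitz_on UNIV w"
      unfolding I_def[symmetric]
      using \<open>0 < C\<close> by (intro lipschitz_pw_affine_field[OF mesh w _ aff]) (auto simp: I_def)
  qed
qed

text \<open>A field that vanishes outside \<open>\<Omega>\<close> is compared with its value zero at a point \<open>y\<close> outside \<open>\<Omega>\<close>, at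
  distance at most \<open>2 R\<close> from every point of \<open>\<Omega>\<close>.\<close>

lemma L2_le_lipschitz:
  fixes \<Omega> :: "(real^'n) set"
  assumes "open \<Omega>" "bounded \<Omega>"
  obtains C where "0 \<le> C"
    "\<And>w L. L-lipschitz_on UNIV w \<Longrightarrow> (\<And>x. x \<notin> \<Omega> \<Longrightarrow> w x = 0) \<Longrightarrow>
       (LINT x|lebesgue_on \<Omega>. (norm (w x :: real^'n))\<^sup>2) \<le> C * L\<^sup>2"
proof -
  obtain R where R: "0 < R" "\<And>x. x \<in> \<Omega> \<Longrightarrow> norm x < R"
    using bounded_pos_less[of \<Omega>] \<open>bounded \<Omega>\<close> by blast
  have fin: "finite_measure (lebesgue_on \<Omega>)"
    by (rule finite_measure_lebesgue_on_bounded[OF assms])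
  define C where "C = (2 * R)\<^sup>2 * measure (lebesgue_on \<Omega>) (space (lebesgue_on \<Omega>))"
  show thesis
  proof (rule that[of C])
    show "0 \<le> C" by (simp add: C_def)
    fix w :: "real^'n \<Rightarrow> real^'n" and L assume w: "L-lipschitz_on UNIV w" and out: "\<And>x. x \<notin> \<Omega> \<Longrightarrow> w x = 0"
    have "0 \<le> L" using w by (rule lipschitz_on_nonneg)
    define y :: "real^'n" where "y = R *\<^sub>R axis undefined 1"
    have ny: "norm y = R" using R(1) by (simp add: y_def)
    then have "y \<notin> \<Omega>" using R(2)[of y] by auto
    then have "w y = 0" by (rule out)
    have bd: "(norm (w x))\<^sup>2 \<le> (2 * R)\<^sup>2 * L\<^sup>2" if "x \<in> \<Omega>" for x
    proof -
      have "norm (w x) \<le> L * norm (x - y)"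
        using lipschitz_onD[OF w, of x y] \<open>w y = 0\<close> by (simp add: dist_norm)
      also have "\<dots> \<le> L * (2 * R)"
        using norm_triangle_ineq4[of x y] ny R(2)[OF that] by (intro mult_left_mono \<open>0 \<le> L\<close>) simp
      finally have "(norm (w x))\<^sup>2 \<le> (L * (2 * R))\<^sup>2" by (intro power_mono) auto
      then show ?thesis by (simp add: power_mult_distrib mult_ac)
    qed
    have cw: "continuous_on UNIV w" using w by (rule lipschitz_on_continuous_on)
    have "(LINT x|lebesgue_on \<Omega>. (norm (w x))\<^sup>2) \<le> (LINT x|lebesgue_on \<Omega>. (2 * R)\<^sup>2 * L\<^sup>2)"
    proof (rule integral_mono)
      show c: "integrable (lebesgue_on \<Omega>) (\<lambda>x. (2 * R)\<^sup>2 * L\<^sup>2)"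
        by (rule finite_measure.integrable_const[OF fin])
      show "integrable (lebesgue_on \<Omega>) (\<lambda>x. (norm (w x))\<^sup>2)"
      proof (rule Bochner_Integration.integrable_bound[OF c])
        show "(\<lambda>x. (norm (w x))\<^sup>2) \<in> borel_measurable (lebesgue_on \<Omega>)"
          by (intro measurable_restrict_space1 lebesgue_measurable_continuous continuous_on_power continuous_on_norm cw)
        show "AE x in lebesgue_on \<Omega>. norm ((norm (w x))\<^sup>2) \<le> norm ((2 * R)\<^sup>2 * L\<^sup>2)"
          by (rule AE_I2) (use bd in simp)
      qed
      show "(norm (w x))\<^sup>2 \<le> (2 * R)\<^sup>2 * L\<^sup>2" if "x \<in> space (lebesgue_on \<Omega>)" for x
        using bd that by simp
    qed
    also have "\<dots> = C * L\<^sup>2" by (simp add: C_def mult_ac)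
    finally show "(LINT x|lebesgue_on \<Omega>. (norm (w x))\<^sup>2) \<le> C * L\<^sup>2" .
  qed
qed

section \<open>Gaussian smoothing\<close>

lemma gaussian_scale:
  fixes z :: "real^'n"
  assumes "0 < \<epsilon>"
  shows "gaussian \<epsilon> (\<epsilon> *\<^sub>R z) = gaussian 1 z / \<epsilon> ^ CARD('n)"
proof -
  have "(\<epsilon>\<^sup>2) powr (real CARD('n) / 2) = (\<epsilon> powr 2) powr (real CARD('n) / 2)"
    using assms by simp
  also have "\<dots> = \<epsilon> powr (2 * (real CARD('n) / 2))" by (rule powr_powr)
  also have "\<dots> = \<epsilon> ^ CARD('n)" using assms by (simp add: powr_realpow)
  finally have "(2 * pi * \<epsilon>\<^sup>2) powr (real CARD('n) / 2) = (2 * pi) powr (real CARD('n) / 2) * \<epsilon> ^ CARD('n)"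
    using assms by (simp add: powr_mult)
  moreover have "(norm (\<epsilon> *\<^sub>R z))\<^sup>2 / (2 * \<epsilon>\<^sup>2) = (norm z)\<^sup>2 / (2 * 1\<^sup>2)"
    using assms by (simp add: power_mult_distrib)
  ultimately show ?thesis unfolding gaussian_def by simp
qed

text \<open>The Gaussian of width one is the product of the one-dimensional normal densities, so its integral and its
  first absolute moment reduce to one dimension.\<close>

lemma gaussian_1_eq_prod:
  fixes z :: "real^'n"
  shows "gaussian 1 z = (\<Prod>b\<in>Basis. std_normal_density (z \<bullet> b))"
proof -
  have "(2 * pi) powr (real CARD('n) / 2) = ((2 * pi) powr (1/2)) powr (real CARD('n))"
    by (simp add: powr_powr)
  also have "\<dots> = (sqrt (2 * pi)) ^ CARD('n)" by (simp add: powr_half_sqrt powr_realpow)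
  finally have c: "(2 * pi) powr (real CARD('n) / 2) = (sqrt (2 * pi)) ^ CARD('n)" .
  have n: "(norm z)\<^sup>2 = (\<Sum>b\<in>Basis. (z \<bullet> b)\<^sup>2)"
    unfolding power2_norm_eq_inner by (subst euclidean_inner) (simp add: power2_eq_square)
  have "(\<Prod>b\<in>Basis. std_normal_density (z \<bullet> b))
      = (\<Prod>b\<in>(Basis :: (real^'n) set). 1 / sqrt (2 * pi)) * (\<Prod>b\<in>Basis. exp (- (z \<bullet> b)\<^sup>2 / 2))"
    unfolding std_normal_density_def by (rule prod.distrib)
  also have "(\<Prod>b\<in>Basis. exp (- (z \<bullet> b)\<^sup>2 / 2)) = exp (\<Sum>b\<in>Basis. - (z \<bullet> b)\<^sup>2 / 2)"
    by (rule exp_sum[symmetric]) simp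
  also have "(\<Sum>b\<in>Basis. - (z \<bullet> b)\<^sup>2 / 2) = - ((norm z)\<^sup>2 / 2)"
    unfolding n by (simp add: sum_negf sum_divide_distrib)
  also have "(\<Prod>b\<in>(Basis :: (real^'n) set). 1 / sqrt (2 * pi)) = 1 / (sqrt (2 * pi)) ^ CARD('n)"
    by (simp add: power_divide)
  finally show ?thesis unfolding gaussian_def by (simp add: c)
qed

lemma continuous_on_gaussian: "continuous_on UNIV (gaussian \<epsilon> :: real^'n \<Rightarrow> real)"
proof (cases "\<epsilon> = 0")
  case True
  then show ?thesis by (simp add: gaussian_def[abs_def] continuous_on_const)
next
  case False
  then show ?thesis
    unfolding gaussian_def[abs_def]
    by (intro continuous_on_mult continuous_on_const continuous_on_exp continuous_on_minus
        continuous_on_divide continuous_on_power continuous_on_norm continuous_on_id) simp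
qed

lemma gaussian_nonneg: "0 \<le> gaussian \<epsilon> x"
  by (simp add: gaussian_def)

lemma gaussian_measurable [measurable]: "(gaussian \<epsilon> :: real^'n \<Rightarrow> real) \<in> borel_measurable borel"
  by (rule borel_measurable_continuous_onI[OF continuous_on_gaussian])

lemma has_bochner_integral_gaussian_1:
  "has_bochner_integral lborel (gaussian 1 :: real^'n \<Rightarrow> real) 1"
proof (rule has_bochner_integral_nn_integral)
  have one: "(\<integral>\<^sup>+t. ennreal (std_normal_density t) \<partial>lborel) = 1"
    by (subst nn_integral_eq_integral) simp_all
  have "(\<integral>\<^sup>+x. ennreal (gaussian 1 (x :: real^'n)) \<partial>lborel)
      = (\<integral>\<^sup>+(x :: real^'n). (\<Prod>b\<in>Basis. ennreal (std_normal_density (x \<bullet> b))) \<partial>lborel)"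
    unfolding gaussian_1_eq_prod by (simp add: prod_ennreal)
  also have "\<dots> = (\<Prod>b\<in>(Basis :: (real^'n) set). (\<integral>\<^sup>+t. ennreal (std_normal_density t) \<partial>lborel))"
    by (rule nn_integral_lborel_prod) auto
  finally show "(\<integral>\<^sup>+x. ennreal (gaussian 1 (x :: real^'n)) \<partial>lborel) = ennreal 1"
    by (simp add: one)
qed (auto simp: gaussian_nonneg)

lemma integrable_gaussian_1_norm:
  "integrable lborel (\<lambda>z :: real^'n. gaussian 1 z * norm z)"
proof (rule Bochner_Integration.integrable_bound)
  have "integrable lborel (\<lambda>z :: real^'n. gaussian 1 z * \<bar>z \<bullet> b\<bar>)" if b: "b \<in> Basis" for b
  proof (rule integrableI_nonneg)
    \<comment> \<open>The factor for direction \<open>b\<close> absorbs \<open>\<bar>z \<bullet> b\<bar>\<close>, so that the integrand is again a product.\<close>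
    define f where "f = (\<lambda>c t. if c = b then std_normal_density t * \<bar>t\<bar> else std_normal_density t)"
    have fm: "f c \<in> borel_measurable borel" for c by (simp add: f_def)
    have fn: "0 \<le> f c t" for c t by (simp add: f_def)
    have fin: "(\<integral>\<^sup>+t. ennreal (f c t) \<partial>lborel) < \<infinity>" for c
    proof -
      have "integrable lborel (\<lambda>t. std_normal_density t * \<bar>t\<bar>)"
        using std_normal_moment_abs_odd[of 0] by (simp add: has_bochner_integral_iff)
      then have "integrable lborel (f c)"
        by (cases "c = b") (simp_all add: f_def)
      then show ?thesis using fn by (simp add: nn_integral_eq_integral)
    qed
    have "gaussian 1 z * \<bar>z \<bullet> b\<bar> = (\<Prod>c\<in>Basis. f c (z \<bullet> c))" for z :: "real^'n"
    proof -
      have "(\<Prod>c\<in>Basis. f c (z \<bullet> c)) = f b (z \<bullet> b) * (\<Prod>c\<in>Basis - {b}. f c (z \<bullet> c))"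
        using b by (simp add: prod.remove)
      also have "(\<Prod>c\<in>Basis - {b}. f c (z \<bullet> c)) = (\<Prod>c\<in>Basis - {b}. std_normal_density (z \<bullet> c))"
        by (rule prod.cong) (auto simp: f_def)
      finally show ?thesis
        unfolding gaussian_1_eq_prod using b by (simp add: f_def prod.remove[of Basis b])
    qed
    then have "(\<integral>\<^sup>+z. ennreal (gaussian 1 (z :: real^'n) * \<bar>z \<bullet> b\<bar>) \<partial>lborel)
        = (\<integral>\<^sup>+(z :: real^'n). (\<Prod>c\<in>Basis. ennreal (f c (z \<bullet> c))) \<partial>lborel)"
      using fn by (simp add: prod_ennreal)
    also have "\<dots> = (\<Prod>c\<in>(Basis :: (real^'n) set). (\<integral>\<^sup>+t. ennreal (f c t) \<partial>lborel))"
      using fm by (intro nn_integral_lborel_prod) auto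
    also have "\<dots> < \<infinity>"
    proof -
      have "(\<integral>\<^sup>+t. ennreal (f c t) \<partial>lborel) \<noteq> top" for c using fin[of c] by simp
      then have "(\<Prod>c\<in>(Basis :: (real^'n) set). (\<integral>\<^sup>+t. ennreal (f c t) \<partial>lborel)) \<noteq> top"
        by (simp add: ennreal_prod_eq_top)
      then show ?thesis by (simp add: less_top)
    qed
    finally show "(\<integral>\<^sup>+z. ennreal (gaussian 1 (z :: real^'n) * \<bar>z \<bullet> b\<bar>) \<partial>lborel) < \<infinity>" .
  qed (auto simp: gaussian_nonneg)
  then show "integrable lborel (\<lambda>z :: real^'n. \<Sum>b\<in>Basis. gaussian 1 z * \<bar>z \<bullet> b\<bar>)"
    by (intro Bochner_Integration.integrable_sum)
  have "gaussian 1 z * norm z \<le> (\<Sum>b\<in>Basis. gaussian 1 z * \<bar>z \<bullet> b\<bar>)" for z :: "real^'n"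
    unfolding sum_distrib_left[symmetric] by (intro mult_left_mono norm_le_l1 gaussian_nonneg)
  then have "norm (gaussian 1 z * norm z) \<le> norm (\<Sum>b\<in>Basis. gaussian 1 z * \<bar>z \<bullet> b\<bar>)" for z :: "real^'n"
    using gaussian_nonneg[of 1 z] by (simp add: abs_mult order_trans[OF _ abs_ge_self])
  then show "AE z :: real^'n in lborel. norm (gaussian 1 z * norm z) \<le> norm (\<Sum>b\<in>Basis. gaussian 1 z * \<bar>z \<bullet> b\<bar>)"
    by (intro AE_I2)
qed measurable

lemma integral_lborel_affine:
  fixes f :: "'a::euclidean_space \<Rightarrow> real"
  assumes [measurable]: "f \<in> borel_measurable borel" and "0 < c"
  shows "(LINT x|lborel. f x) = c ^ DIM('a) * (LINT x|lborel. f (t + c *\<^sub>R x))"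
proof -
  have "(LINT x|lborel. f x) = (LINT x|density (distr lborel borel (\<lambda>x. t + c *\<^sub>R x)) (\<lambda>_. ennreal (c ^ DIM('a))). f x)"
    using lborel_affine[of c t] \<open>0 < c\<close> by simp
  also have "\<dots> = (LINT x|distr lborel borel (\<lambda>x. t + c *\<^sub>R x). c ^ DIM('a) *\<^sub>R f x)"
    using \<open>0 < c\<close> by (intro integral_density) auto
  also have "\<dots> = (LINT x|lborel. c ^ DIM('a) *\<^sub>R f (t + c *\<^sub>R x))"
    by (intro integral_distr) auto
  finally show ?thesis by simp
qed

text \<open>After the substitution \<open>x = y + \<epsilon> z\<close> the error is the integral of
  \<open>gaussian 1 z * (f (y + \<epsilon> z) - f y)\<close>, and the difference is at most \<open>L \<epsilon> \<bar>z\<bar>\<close>.\<close>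

lemma gaussian_smoothing_error:
  fixes f :: "real^'n \<Rightarrow> real"
  assumes f: "L-lipschitz_on UNIV f" and "0 < \<epsilon>"
  shows "\<bar>(LINT x|lebesgue. gaussian \<epsilon> (x - y) * f x) - f y\<bar>
           \<le> L * \<epsilon> * (LINT z|lborel. gaussian 1 (z :: real^'n) * norm z)"
proof -
  have [measurable]: "f \<in> borel_measurable borel"
    by (rule borel_measurable_continuous_onI[OF lipschitz_on_continuous_on[OF f]])
  define F where "F = (\<lambda>z. gaussian 1 z * (f (y + \<epsilon> *\<^sub>R z) - f y))"
  have Fb: "\<bar>F z\<bar> \<le> L * \<epsilon> * (gaussian 1 z * norm z)" for z
  proof -
    have "\<bar>f (y + \<epsilon> *\<^sub>R z) - f y\<bar> \<le> L * (\<epsilon> * norm z)"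
      using lipschitz_onD[OF f, of "y + \<epsilon> *\<^sub>R z" y] \<open>0 < \<epsilon>\<close> by (simp add: dist_norm)
    then have "gaussian 1 z * \<bar>f (y + \<epsilon> *\<^sub>R z) - f y\<bar> \<le> gaussian 1 z * (L * (\<epsilon> * norm z))"
      by (intro mult_left_mono gaussian_nonneg)
    then show ?thesis
      using gaussian_nonneg[of 1 z] by (simp add: F_def abs_mult mult_ac)
  qed
  have iM: "integrable lborel (\<lambda>z :: real^'n. L * \<epsilon> * (gaussian 1 z * norm z))"
    by (intro integrable_mult_right integrable_gaussian_1_norm)
  have iF: "integrable lborel F"
  proof (rule Bochner_Integration.integrable_bound[OF iM])
    show "F \<in> borel_measurable lborel" unfolding F_def by measurable
    show "AE z in lborel. norm (F z) \<le> norm (L * \<epsilon> * (gaussian 1 z * norm z))"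
      unfolding real_norm_def by (intro AE_I2 order_trans[OF Fb abs_ge_self])
  qed
  have g: "integrable lborel (gaussian 1 :: real^'n \<Rightarrow> real)" "(LINT z|lborel. gaussian 1 (z :: real^'n)) = 1"
    using has_bochner_integral_gaussian_1 by (auto simp: has_bochner_integral_iff)
  have "(LINT x|lebesgue. gaussian \<epsilon> (x - y) * f x) = (LINT x|lborel. gaussian \<epsilon> (x - y) * f x)"
    by (rule integral_completion) measurable
  also have "\<dots> = \<epsilon> ^ CARD('n) * (LINT z|lborel. gaussian \<epsilon> (y + \<epsilon> *\<^sub>R z - y) * f (y + \<epsilon> *\<^sub>R z))"
    by (subst integral_lborel_affine[where c = \<epsilon> and t = y]) (use \<open>0 < \<epsilon>\<close> in simp_all)
  also have "\<dots> = (LINT z|lborel. \<epsilon> ^ CARD('n) * (gaussian \<epsilon> (\<epsilon> *\<^sub>R z) * f (y + \<epsilon> *\<^sub>R z)))"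
    by simp
  also have "\<dots> = (LINT z|lborel. F z + gaussian 1 z * f y)"
    using \<open>0 < \<epsilon>\<close> by (intro Bochner_Integration.integral_cong refl) (simp add: gaussian_scale F_def algebra_simps)
  also have "\<dots> = (LINT z|lborel. F z) + f y"
    using iF g by simp
  finally have "\<bar>(LINT x|lebesgue. gaussian \<epsilon> (x - y) * f x) - f y\<bar> = \<bar>LINT z|lborel. F z\<bar>" by simp
  also have "\<dots> \<le> (LINT z|lborel. \<bar>F z\<bar>)" by (rule integral_abs_bound)
  also have "\<dots> \<le> (LINT z|lborel. L * \<epsilon> * (gaussian 1 (z :: real^'n) * norm z))"
    by (intro integral_mono integrable_abs iF iM Fb)
  finally show ?thesis by simp
qed

text \<open>The points of application need not lie in \<open>\<Omega>\<close> for this estimate: the field vanishes outside \<open>\<Omega>\<close>, so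
  the smoothed load is an integral over the whole space and no boundary term arises.\<close>

lemma load_error:
  fixes \<Omega> :: "(real^'n) set" and w :: "real^'n \<Rightarrow> real^'n"
  assumes "open \<Omega>" "bounded \<Omega>" and w: "L-lipschitz_on UNIV w" and out: "\<And>x. x \<notin> \<Omega> \<Longrightarrow> w x = 0"
    and "0 < \<Delta>x" "0 < \<epsilon>"
  shows "\<bar>smoothed_load \<Omega> P x' \<Delta>x \<epsilon> w - point_load P x' \<Delta>x w\<bar>
     \<le> \<bar>P\<bar> * \<Delta>x ^ (CARD('n) - 1)
         * (2 * CARD('n) * (L * \<epsilon> * (LINT z|lborel. gaussian 1 (z :: real^'n) * norm z)))"
proof -
  define c where "c = P * \<Delta>x ^ (CARD('n) - 1)"
  define M where "M = L * \<epsilon> * (LINT z|lborel. gaussian 1 (z :: real^'n) * norm z)"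
  define p where "p = (\<lambda>i. x' - (\<Delta>x / 2) *\<^sub>R axis i 1)"
  define q where "q = (\<lambda>i. x' + (\<Delta>x / 2) *\<^sub>R axis i 1)"
  have wi: "L-lipschitz_on UNIV (\<lambda>x. w x $ i)" for i
    using w unfolding lipschitz_on_def by (meson dist_vec_nth_le order_trans)
  have cw: "continuous_on UNIV (\<lambda>x. w x $ i)" for i by (rule lipschitz_on_continuous_on[OF wi])
  have cg: "continuous_on UNIV (\<lambda>x :: real^'n. gaussian \<epsilon> (x - y))" for y
    by (rule continuous_on_compose2[OF continuous_on_gaussian])
      (intro continuous_on_diff continuous_on_id continuous_on_const subset_UNIV)+
  have cgw: "continuous_on UNIV (\<lambda>x. gaussian \<epsilon> (x - y) * w x $ i)" for y i
    by (intro continuous_on_mult cg cw)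
  have int: "integrable lebesgue (\<lambda>x. gaussian \<epsilon> (x - y) * w x $ i)" for y i
  proof (rule integrable_continuous_bounded_support[OF cgw])
    show "bounded {x. gaussian \<epsilon> (x - y) * w x $ i \<noteq> 0}"
      by (rule bounded_subset[OF \<open>bounded \<Omega>\<close>]) (use out in force)
  qed
  define h where "h = (\<lambda>x. c * (\<Sum>i\<in>UNIV. gaussian \<epsilon> (x - p i) * w x $ i - gaussian \<epsilon> (x - q i) * w x $ i))"
  have h: "smoothed_force P x' \<Delta>x \<epsilon> x \<bullet> w x = h x" for x
    by (simp add: smoothed_force_def h_def c_def p_def q_def inner_sum_left inner_axis' left_diff_distrib
        diff_diff_eq diff_diff_eq2 algebra_simps)
  have ih: "integrable lebesgue h"
    unfolding h_def using int by (intro integrable_mult_right Bochner_Integration.integrable_sum Bochner_Integration.integrable_diff)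
  have "smoothed_load \<Omega> P x' \<Delta>x \<epsilon> w = (LINT x|lebesgue_on \<Omega>. h x)"
    by (simp add: smoothed_load_def h)
  also have "\<dots> = (LINT x|lebesgue. h x)"
    using \<open>open \<Omega>\<close> ih out by (intro integral_lebesgue_on_eq) (auto simp: h_def)
  also have "\<dots> = c * (\<Sum>i\<in>UNIV. (LINT x|lebesgue. gaussian \<epsilon> (x - p i) * w x $ i)
      - (LINT x|lebesgue. gaussian \<epsilon> (x - q i) * w x $ i))"
    unfolding h_def using int by simp
  finally have S: "smoothed_load \<Omega> P x' \<Delta>x \<epsilon> w = \<dots>" .
  have T: "point_load P x' \<Delta>x w = c * (\<Sum>i\<in>UNIV. w (p i) $ i - w (q i) $ i)"
    by (simp add: point_load_def c_def p_def q_def inner_axis')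
  have "\<bar>smoothed_load \<Omega> P x' \<Delta>x \<epsilon> w - point_load P x' \<Delta>x w\<bar>
     = \<bar>c\<bar> * \<bar>\<Sum>i\<in>UNIV. ((LINT x|lebesgue. gaussian \<epsilon> (x - p i) * w x $ i) - w (p i) $ i)
        - ((LINT x|lebesgue. gaussian \<epsilon> (x - q i) * w x $ i) - w (q i) $ i)\<bar>"
    unfolding S T right_diff_distrib[symmetric] abs_mult sum_subtractf[symmetric]
    by (simp add: algebra_simps)
  also have "\<dots> \<le> \<bar>c\<bar> * (\<Sum>i\<in>(UNIV :: 'n set). 2 * M)"
  proof (intro mult_left_mono order_trans[OF sum_abs] sum_mono abs_ge_zero)
    fix i :: 'n
    show "\<bar>((LINT x|lebesgue. gaussian \<epsilon> (x - p i) * w x $ i) - w (p i) $ i)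
        - ((LINT x|lebesgue. gaussian \<epsilon> (x - q i) * w x $ i) - w (q i) $ i)\<bar> \<le> 2 * M"
      using gaussian_smoothing_error[OF wi[of i] \<open>0 < \<epsilon>\<close>, of "p i"]
        gaussian_smoothing_error[OF wi[of i] \<open>0 < \<epsilon>\<close>, of "q i"]
      unfolding M_def by linarith
  qed
  also have "\<dots> = \<bar>P\<bar> * \<Delta>x ^ (CARD('n) - 1) * (2 * CARD('n) * M)"
    using \<open>0 < \<Delta>x\<close> by (simp add: c_def abs_mult)
  finally show ?thesis unfolding M_def .
qed

section \<open>Coercivity and the error estimate\<close>

text \<open>The symmetric part; the strain of a field is the symmetric part of its weak gradient.\<close>

definition sym_part :: "real^'n^'n \<Rightarrow> real^'n^'n" where
  "sym_part M = (1/2) *\<^sub>R (M + transpose M)"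

text \<open>The integrand of the elastic energy form, stress of the gradient \<open>M\<close> contracted with strain of the gradient \<open>N\<close>.\<close>

definition elastic_density :: "real \<Rightarrow> real \<Rightarrow> real^'n^'n \<Rightarrow> real^'n^'n \<Rightarrow> real" where
  "elastic_density E \<nu> M N =
     E / (1 + \<nu>) * (sym_part M \<bullet> sym_part N + \<nu> / (1 - 2 * \<nu>) * (trace M * trace N))"

lemma trace_sym_part: "trace (sym_part M) = trace M"
  by (simp add: trace_def sym_part_def transpose_def)

lemma inner_mat_1: "mat 1 \<bullet> N = trace (N :: real^'n^'n)"
proof -
  have "mat 1 \<bullet> N = (\<Sum>i\<in>UNIV. \<Sum>j\<in>UNIV. (if i = j then N $ i $ j else 0))"
    by (simp add: inner_vec_def mat_def if_distrib[of "\<lambda>a. a * _"] cong: if_cong)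
  then show ?thesis by (simp add: trace_def)
qed

lemma stress_inner_strain:
  "stress E \<nu> \<Omega> u x \<bullet> strain \<Omega> v x = elastic_density E \<nu> (weak_gradient \<Omega> u x) (weak_gradient \<Omega> v x)"
  unfolding stress_def strain_def sym_part_def[symmetric] elastic_density_def
  by (simp add: inner_add_left inner_mat_1 trace_sym_part mult_ac)

lemma elastic_density_diff_left:
  "elastic_density E \<nu> (A - B) N = elastic_density E \<nu> A N - elastic_density E \<nu> B N"
proof -
  have sub: "sym_part (A - B) = sym_part A - sym_part B"
  proof -
    have "transpose (A - B) = transpose A - transpose B"
      by (simp add: vec_eq_iff transpose_def)
    then show ?thesis
      unfolding sym_part_def by (simp only: scaleR_diff_right[symmetric]) (simp add: algebra_simps)
  qed
  show ?thesis
    unfolding elastic_density_def trace_sub sub inner_diff_left by (simp add: algebra_simps)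
qed

text \<open>Written as a sum of products of entries, the density inherits measurability and integrability from those products.\<close>

lemma elastic_density_components:
  "elastic_density E \<nu> M N = E / (1 + \<nu>) *
     ((\<Sum>i\<in>UNIV. \<Sum>j\<in>UNIV. (1/4) * (M $ i $ j * N $ i $ j + M $ i $ j * N $ j $ i
          + M $ j $ i * N $ i $ j + M $ j $ i * N $ j $ i))
      + \<nu> / (1 - 2 * \<nu>) * (\<Sum>i\<in>UNIV. \<Sum>j\<in>UNIV. M $ i $ i * N $ j $ j))"
proof -
  have "sym_part M \<bullet> sym_part N = (\<Sum>i\<in>UNIV. \<Sum>j\<in>UNIV. (sym_part M $ i $ j) * (sym_part N $ i $ j))"
    by (simp add: inner_vec_def)
  also have "\<dots> = (\<Sum>i\<in>UNIV. \<Sum>j\<in>UNIV. (1/4) * (M $ i $ j * N $ i $ j + M $ i $ j * N $ j $ i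
          + M $ j $ i * N $ i $ j + M $ j $ i * N $ j $ i))"
    by (intro sum.cong refl) (simp add: sym_part_def transpose_def algebra_simps)
  finally show ?thesis
    by (simp add: elastic_density_def trace_def sum_product)
qed

lemma elastic_density_measurable:
  fixes G H :: "real^'n \<Rightarrow> real^'n^'n"
  assumes "G \<in> borel_measurable M" "H \<in> borel_measurable M"
  shows "(\<lambda>x. elastic_density E \<nu> (G x) (H x)) \<in> borel_measurable M"
  unfolding elastic_density_components
  by (intro borel_measurable_times borel_measurable_add borel_measurable_const borel_measurable_sum
      component2_measurable assms)

lemma integrable_elastic_density:
  fixes \<Omega> :: "(real^'n) set"
  assumes "open \<Omega>" "bounded \<Omega>" "mesh_of \<Omega> \<T>" "pw_affine_field \<Omega> \<T> u" "pw_affine_field \<Omega> \<T> v"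
  shows "integrable (lebesgue_on \<Omega>) (\<lambda>x. elastic_density E \<nu> (gradient_matrix u x) (gradient_matrix v x))"
proof -
  have "\<Omega> \<in> sets lebesgue" using \<open>open \<Omega>\<close> by simp
  then show ?thesis
    unfolding elastic_density_components
    by (intro integrable_lebesgue_on integrable_mult_right Bochner_Integration.integrable_add
        Bochner_Integration.integrable_sum integrable_gradient_matrix_mult[OF assms(2-)]
        integrable_gradient_matrix_mult[OF assms(2-5)])
qed

lemma elastic_form_eq:
  fixes \<Omega> :: "(real^'n) set"
  assumes "open \<Omega>" "bounded \<Omega>" "mesh_of \<Omega> \<T>" and u: "pw_affine_field \<Omega> \<T> u" and v: "pw_affine_field \<Omega> \<T> v"
  shows "elastic_form E \<nu> \<Omega> u v
     = (LINT x|lebesgue_on \<Omega>. elastic_density E \<nu> (gradient_matrix u x) (gradient_matrix v x))"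
  unfolding elastic_form_def stress_inner_strain
proof (rule integral_cong_AE)
  have meas: "weak_gradient \<Omega> w \<in> borel_measurable (lebesgue_on \<Omega>)" if "pw_affine_field \<Omega> \<T> w" for w
    using has_weak_gradient_weak_gradient[OF has_weak_gradient_pw_affine_field[OF assms(1-3) that]]
    by (simp add: has_weak_gradient_def square_integrable_field_def)
  show "(\<lambda>x. elastic_density E \<nu> (weak_gradient \<Omega> u x) (weak_gradient \<Omega> v x)) \<in> borel_measurable (lebesgue_on \<Omega>)"
    by (intro elastic_density_measurable meas u v)
  show "(\<lambda>x. elastic_density E \<nu> (gradient_matrix u x) (gradient_matrix v x)) \<in> borel_measurable (lebesgue_on \<Omega>)"
    by (rule borel_measurable_integrable[OF integrable_elastic_density[OF assms]])
  show "AE x in lebesgue_on \<Omega>. elastic_density E \<nu> (weak_gradient \<Omega> u x) (weak_gradient \<Omega> v x)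
      = elastic_density E \<nu> (gradient_matrix u x) (gradient_matrix v x)"
    using AE_weak_gradient_pw_affine_field[OF assms(1-3) u] AE_weak_gradient_pw_affine_field[OF assms(1-3) v]
    by eventually_elim simp
qed

lemma AE_gradient_matrix_diff:
  fixes \<Omega> :: "(real^'n) set"
  assumes "open \<Omega>" and mesh: "mesh_of \<Omega> \<T>" and u: "pw_affine_field \<Omega> \<T> u" and v: "pw_affine_field \<Omega> \<T> v"
  shows "AE x in lebesgue_on \<Omega>. gradient_matrix (\<lambda>x. u x - v x) x = gradient_matrix u x - gradient_matrix v x"
proof -
  have "AE x in lebesgue. gradient_matrix (\<lambda>x. u x - v x) x = gradient_matrix u x - gradient_matrix v x"
    using AE_GDERIV_pw_affine_field[OF mesh u] AE_GDERIV_pw_affine_field[OF mesh v]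
  proof eventually_elim
    case (elim x)
    have "gradient_matrix (\<lambda>x. u x - v x) x $ i = gradient_matrix u x $ i - gradient_matrix v x $ i" for i
    proof (rule gradient_matrix_eq)
      have "GDERIV (\<lambda>y. u y $ i - v y $ i) x :> gradient_matrix u x $ i - gradient_matrix v x $ i"
        using elim by (intro GDERIV_diff) auto
      then show "GDERIV (\<lambda>y. (u y - v y) $ i) x :> gradient_matrix u x $ i - gradient_matrix v x $ i"
        by simp
    qed
    then show ?case by (simp add: vec_eq_iff)
  qed
  then show ?thesis
    using \<open>open \<Omega>\<close> by (subst AE_restrict_space_iff) (auto elim!: eventually_mono)
qed

lemma elastic_form_diff_left:
  fixes \<Omega> :: "(real^'n) set"
  assumes \<Omega>: "open \<Omega>" "bounded \<Omega>" and mesh: "mesh_of \<Omega> \<T>"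
    and u: "pw_affine_field \<Omega> \<T> u" and v: "pw_affine_field \<Omega> \<T> v" and w: "pw_affine_field \<Omega> \<T> w"
    and uv: "pw_affine_field \<Omega> \<T> (\<lambda>x. u x - v x)"
  shows "elastic_form E \<nu> \<Omega> (\<lambda>x. u x - v x) w = elastic_form E \<nu> \<Omega> u w - elastic_form E \<nu> \<Omega> v w"
proof -
  note int = integrable_elastic_density[OF \<Omega> mesh _ w, of _ E \<nu>]
  have "elastic_form E \<nu> \<Omega> (\<lambda>x. u x - v x) w
     = (LINT x|lebesgue_on \<Omega>. elastic_density E \<nu> (gradient_matrix u x) (gradient_matrix w x)
          - elastic_density E \<nu> (gradient_matrix v x) (gradient_matrix w x))"
    unfolding elastic_form_eq[OF \<Omega> mesh uv w]
  proof (rule integral_cong_AE)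
    show "AE x in lebesgue_on \<Omega>. elastic_density E \<nu> (gradient_matrix (\<lambda>x. u x - v x) x) (gradient_matrix w x)
      = elastic_density E \<nu> (gradient_matrix u x) (gradient_matrix w x)
          - elastic_density E \<nu> (gradient_matrix v x) (gradient_matrix w x)"
      using AE_gradient_matrix_diff[OF \<Omega>(1) mesh u v]
      by eventually_elim (simp add: elastic_density_diff_left)
  qed (use int[OF u] int[OF v] int[OF uv] in auto)
  also have "\<dots> = elastic_form E \<nu> \<Omega> u w - elastic_form E \<nu> \<Omega> v w"
    unfolding elastic_form_eq[OF \<Omega> mesh u w] elastic_form_eq[OF \<Omega> mesh v w]
    by (rule Bochner_Integration.integral_diff[OF int[OF u] int[OF v]])
  finally show ?thesis .
qed

text \<open>For \<open>0 \<le> \<nu> < 1/2\<close> the trace term of the energy is nonnegative and can be dropped; the rest is the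
  squared strain, to which Korn's inequality applies.\<close>

lemma elastic_form_coercive:
  fixes \<Omega> :: "(real^'n) set"
  assumes \<Omega>: "open \<Omega>" "bounded \<Omega>" and mesh: "mesh_of \<Omega> \<T>" and w: "pw_affine_field \<Omega> \<T> w"
    and "0 < E" "0 \<le> \<nu>" "\<nu> < 1/2"
  shows "E / (2 * (1 + \<nu>)) * (LINT x|lebesgue_on \<Omega>. (norm (gradient_matrix w x))\<^sup>2) \<le> elastic_form E \<nu> \<Omega> w w"
proof -
  let ?G = "gradient_matrix w"
  have dens: "E / (1 + \<nu>) * (norm (sym_part M))\<^sup>2 \<le> elastic_density E \<nu> M M" for M :: "real^'n^'n"
  proof -
    have "0 \<le> \<nu> / (1 - 2 * \<nu>) * (trace M * trace M)"
      using \<open>0 \<le> \<nu>\<close> \<open>\<nu> < 1/2\<close> by (intro mult_nonneg_nonneg[OF divide_nonneg_nonneg zero_le_square]) auto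
    then show ?thesis
      unfolding elastic_density_def power2_norm_eq_inner using \<open>0 < E\<close> \<open>0 \<le> \<nu>\<close>
      by (intro mult_left_mono) auto
  qed
  have sym: "integrable (lebesgue_on \<Omega>) (\<lambda>x. (norm (sym_part (?G x)))\<^sup>2)"
  proof -
    have "(norm (sym_part M))\<^sup>2 = elastic_density 1 0 M M" for M :: "real^'n^'n"
      by (simp add: elastic_density_def power2_norm_eq_inner)
    then show ?thesis using integrable_elastic_density[OF \<Omega> mesh w w, of 1 0] by simp
  qed
  have "E / (2 * (1 + \<nu>)) * (LINT x|lebesgue_on \<Omega>. (norm (?G x))\<^sup>2)
     \<le> E / (2 * (1 + \<nu>)) * (2 * (LINT x|lebesgue_on \<Omega>. (norm (sym_part (?G x)))\<^sup>2))"
    unfolding sym_part_def using \<open>0 < E\<close> \<open>0 \<le> \<nu>\<close>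
    by (intro mult_left_mono korn_inequality_pw_affine_field[OF \<Omega> mesh w]) auto
  also have "\<dots> = (LINT x|lebesgue_on \<Omega>. E / (1 + \<nu>) * (norm (sym_part (?G x)))\<^sup>2)"
    using \<open>0 \<le> \<nu>\<close> by (simp add: field_simps)
  also have "\<dots> \<le> (LINT x|lebesgue_on \<Omega>. elastic_density E \<nu> (?G x) (?G x))"
    using sym by (intro integral_mono integrable_elastic_density[OF \<Omega> mesh w w] dens) simp
  also have "\<dots> = elastic_form E \<nu> \<Omega> w w"
    by (rule elastic_form_eq[OF \<Omega> mesh w w, symmetric])
  finally show ?thesis .
qed

lemma H1_norm_eq:
  fixes \<Omega> :: "(real^'n) set"
  assumes "open \<Omega>" "bounded \<Omega>" and mesh: "mesh_of \<Omega> \<T>" and w: "pw_affine_field \<Omega> \<T> w"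
  shows "H1_norm \<Omega> w = sqrt ((LINT x|lebesgue_on \<Omega>. (norm (w x))\<^sup>2)
     + (LINT x|lebesgue_on \<Omega>. (norm (gradient_matrix w x))\<^sup>2))"
proof -
  have [measurable]: "weak_gradient \<Omega> w \<in> borel_measurable (lebesgue_on \<Omega>)"
    "gradient_matrix w \<in> borel_measurable (lebesgue_on \<Omega>)"
    using has_weak_gradient_pw_affine_field[OF assms]
      has_weak_gradient_weak_gradient[OF has_weak_gradient_pw_affine_field[OF assms]]
    by (simp_all add: has_weak_gradient_def square_integrable_field_def)
  have "(LINT x|lebesgue_on \<Omega>. (norm (weak_gradient \<Omega> w x))\<^sup>2) = (LINT x|lebesgue_on \<Omega>. (norm (gradient_matrix w x))\<^sup>2)"
  proof (rule integral_cong_AE)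
    show "AE x in lebesgue_on \<Omega>. (norm (weak_gradient \<Omega> w x))\<^sup>2 = (norm (gradient_matrix w x))\<^sup>2"
      using AE_weak_gradient_pw_affine_field[OF assms] by eventually_elim simp
  qed measurable
  then show ?thesis by (simp add: H1_norm_def)
qed

text \<open>Two opposite corners of the cell are at distance at least \<open>\<Delta>x\<close>.\<close>

lemma cell_side_le:
  fixes \<Omega> :: "(real^'n) set"
  assumes "\<And>x. x \<in> \<Omega> \<Longrightarrow> norm x \<le> R" "0 < \<Delta>x" "cell x' \<Delta>x \<subseteq> \<Omega>"
  shows "\<Delta>x \<le> 2 * R"
proof -
  define p where "p = x' - (vec (\<Delta>x / 2) :: real^'n)"
  define q where "q = x' + (vec (\<Delta>x / 2) :: real^'n)"
  have "p \<in> cell x' \<Delta>x" "q \<in> cell x' \<Delta>x"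
    using \<open>0 < \<Delta>x\<close> by (auto simp: cell_def p_def q_def mem_box_cart)
  then have "norm p \<le> R" "norm q \<le> R" using assms by auto
  moreover have "\<Delta>x = (q - p) $ undefined" by (simp add: p_def q_def)
  moreover have "(q - p) $ undefined \<le> norm (q - p)"
    using component_le_norm_cart[of "q - p" undefined] by linarith
  moreover have "norm (q - p) \<le> norm q + norm p" by (rule norm_triangle_ineq4)
  ultimately show ?thesis by linarith
qed

theorem theorem3p1:
  fixes \<Omega> :: "(real^'n) set" and \<T> :: "(real^'n) set set"
    and x' :: "real^'n" and P E \<nu> :: real
  assumes "CARD('n) > 1"
    and "open \<Omega>" and "bounded \<Omega>" and "connected \<Omega>"
    and "x' \<in> \<Omega>"
    and "E > 0" and "0 \<le> \<nu>" and "\<nu> < 1/2"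
    and "mesh_of \<Omega> \<T>"
  shows "\<exists>L\<^sub>1>0. \<forall>\<Delta>x>0. \<forall>\<epsilon>>0. cell x' \<Delta>x \<subseteq> \<Omega> \<longrightarrow>
    (\<forall>u\<^sub>h u\<epsilon>\<^sub>h.
       galerkin_solution (elastic_form E \<nu> \<Omega>) (fe_space \<Omega> \<T>) (point_load P x' \<Delta>x) u\<^sub>h \<longrightarrow>
       galerkin_solution (elastic_form E \<nu> \<Omega>) (fe_space \<Omega> \<T>) (smoothed_load \<Omega> P x' \<Delta>x \<epsilon>) u\<epsilon>\<^sub>h \<longrightarrow>
       H1_norm \<Omega> (\<lambda>x. u\<epsilon>\<^sub>h x - u\<^sub>h x) \<le> L\<^sub>1 * \<Delta>x powr ((real CARD('n) - 1) / 2) * \<epsilon>)"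
proof -
  note \<Omega> = \<open>open \<Omega>\<close> \<open>bounded \<Omega>\<close> and mesh = \<open>mesh_of \<Omega> \<T>\<close>
  define s where "s = (real CARD('n) - 1) / 2"
  define n where "n = real CARD('n)"
  define M where "M = (LINT z|lborel. gaussian 1 (z :: real^'n) * norm z)"
  define \<kappa> where "\<kappa> = E / (2 * (1 + \<nu>))"
  obtain C where C: "0 < C" "\<And>w. pw_affine_field \<Omega> \<T> w \<Longrightarrow>
       (C * sqrt (LINT x|lebesgue_on \<Omega>. (norm (gradient_matrix w x))\<^sup>2))-lipschitz_on UNIV w"
    using inverse_estimate[OF \<Omega> mesh] by blast
  obtain K where K: "0 \<le> K" "\<And>(w :: real^'n \<Rightarrow> real^'n) L. L-lipschitz_on UNIV w \<Longrightarrow> (\<And>x. x \<notin> \<Omega> \<Longrightarrow> w x = 0) \<Longrightarrow>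
       (LINT x|lebesgue_on \<Omega>. (norm (w x))\<^sup>2) \<le> K * L\<^sup>2"
    using L2_le_lipschitz[OF \<Omega>] by blast
  obtain R where R: "\<And>x. x \<in> \<Omega> \<Longrightarrow> norm x \<le> R" using \<Omega>(2) by (auto simp: bounded_iff)
  have "0 \<le> M" unfolding M_def by (intro integral_nonneg_AE AE_I2) (simp add: gaussian_nonneg)
  have "0 < \<kappa>" using \<open>E > 0\<close> \<open>0 \<le> \<nu>\<close> by (simp add: \<kappa>_def)
  define D where "D = \<bar>P\<bar> * (2 * n * C * M) / \<kappa>"
  have "0 \<le> D" using \<open>0 \<le> M\<close> \<open>0 < \<kappa>\<close> C(1) by (simp add: D_def n_def)
  define B where "B = sqrt (K * C\<^sup>2 + 1) * D * (2 * \<bar>R\<bar>) powr s"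
  have "0 \<le> B" using \<open>0 \<le> D\<close> K(1) by (simp add: B_def)
  have main: "H1_norm \<Omega> (\<lambda>x. v x - u x) \<le> (1 + B) * \<Delta>x powr s * \<epsilon>"
    if "0 < \<Delta>x" "0 < \<epsilon>" "cell x' \<Delta>x \<subseteq> \<Omega>"
      and u: "galerkin_solution (elastic_form E \<nu> \<Omega>) (fe_space \<Omega> \<T>) (point_load P x' \<Delta>x) u"
      and v: "galerkin_solution (elastic_form E \<nu> \<Omega>) (fe_space \<Omega> \<T>) (smoothed_load \<Omega> P x' \<Delta>x \<epsilon>) v"
    for \<Delta>x \<epsilon> u v
  proof -
    define w where "w = (\<lambda>x. v x - u x)"
    have uV: "u \<in> fe_space \<Omega> \<T>" and vV: "v \<in> fe_space \<Omega> \<T>"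
      using u v by (auto simp: galerkin_solution_def)
    have wV: "w \<in> fe_space \<Omega> \<T>" unfolding w_def by (rule fe_space_diff[OF vV uV])
    note pw = fe_space_pw_affine_field[OF \<Omega>(1) mesh]
    define A where "A = sqrt (LINT x|lebesgue_on \<Omega>. (norm (gradient_matrix w x))\<^sup>2)"
    have "0 \<le> A" by (simp add: A_def)
    have A2: "A\<^sup>2 = (LINT x|lebesgue_on \<Omega>. (norm (gradient_matrix w x))\<^sup>2)"
      by (simp add: A_def)
    have lip: "(C * A)-lipschitz_on UNIV w" unfolding A_def by (rule C(2)[OF pw[OF wV]])
    have out: "w x = 0" if "x \<notin> \<Omega>" for x
      using pw[OF wV] that by (simp add: pw_affine_field_def)
    have "elastic_form E \<nu> \<Omega> w w = elastic_form E \<nu> \<Omega> v w - elastic_form E \<nu> \<Omega> u w"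
      unfolding w_def
      using elastic_form_diff_left[OF \<Omega> mesh pw[OF vV] pw[OF uV] pw[OF wV]] pw[OF wV] unfolding w_def by blast
    also have "\<dots> = smoothed_load \<Omega> P x' \<Delta>x \<epsilon> w - point_load P x' \<Delta>x w"
      using u v wV by (simp add: galerkin_solution_def)
    also have "\<dots> \<le> \<bar>P\<bar> * \<Delta>x ^ (CARD('n) - 1) * (2 * n * (C * A * \<epsilon> * M))"
      using load_error[OF \<Omega> lip out \<open>0 < \<Delta>x\<close> \<open>0 < \<epsilon>\<close>, of P x'] unfolding M_def n_def by simp
    finally have "\<kappa> * A\<^sup>2 \<le> \<bar>P\<bar> * \<Delta>x ^ (CARD('n) - 1) * (2 * n * (C * A * \<epsilon> * M))"
      using elastic_form_coercive[OF \<Omega> mesh pw[OF wV] \<open>E > 0\<close> \<open>0 \<le> \<nu>\<close> \<open>\<nu> < 1/2\<close>]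
      unfolding A2 \<kappa>_def by linarith
    then have "A * A \<le> (D * \<Delta>x ^ (CARD('n) - 1) * \<epsilon>) * A"
      using \<open>0 < \<kappa>\<close> by (simp add: D_def power2_eq_square field_simps)
    \<comment> \<open>Dividing by \<open>A\<close> needs \<open>A \<noteq> 0\<close>; otherwise the bound is trivial.\<close>
    then have A_le: "A \<le> D * \<Delta>x ^ (CARD('n) - 1) * \<epsilon>"
      using \<open>0 \<le> A\<close> \<open>0 \<le> D\<close> \<open>0 < \<Delta>x\<close> \<open>0 < \<epsilon>\<close> by (cases "A = 0") auto
    have "\<Delta>x \<le> 2 * \<bar>R\<bar>"
      using cell_side_le[OF R \<open>0 < \<Delta>x\<close> \<open>cell x' \<Delta>x \<subseteq> \<Omega>\<close>] by linarith
    \<comment> \<open>Here \<open>2 s = n - 1\<close>: one factor \<open>\<Delta>x powr s\<close> is kept, the other is at most \<open>(2 \<bar>R\<bar>) powr s\<close>.\<close>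
    have "\<Delta>x ^ (CARD('n) - 1) = \<Delta>x powr (real (CARD('n) - 1))"
      using \<open>0 < \<Delta>x\<close> by (rule powr_realpow[symmetric])
    also have "\<dots> = \<Delta>x powr s * \<Delta>x powr s"
      using \<open>CARD('n) > 1\<close> by (simp add: powr_add[symmetric] s_def of_nat_diff)
    also have "\<dots> \<le> (2 * \<bar>R\<bar>) powr s * \<Delta>x powr s"
      using \<open>0 < \<Delta>x\<close> \<open>\<Delta>x \<le> 2 * \<bar>R\<bar>\<close> \<open>CARD('n) > 1\<close>
      by (intro mult_right_mono powr_mono2) (auto simp: s_def)
    finally have pow: "\<Delta>x ^ (CARD('n) - 1) \<le> (2 * \<bar>R\<bar>) powr s * \<Delta>x powr s" .
    have "H1_norm \<Omega> w = sqrt ((LINT x|lebesgue_on \<Omega>. (norm (w x))\<^sup>2) + A\<^sup>2)"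
      unfolding A2 by (rule H1_norm_eq[OF \<Omega> mesh pw[OF wV]])
    also have "\<dots> \<le> sqrt (K * (C * A)\<^sup>2 + A\<^sup>2)"
      using K(2)[OF lip out] by simp
    also have "\<dots> = sqrt ((K * C\<^sup>2 + 1) * A\<^sup>2)" by (simp add: power_mult_distrib algebra_simps)
    also have "\<dots> = sqrt (K * C\<^sup>2 + 1) * A" using \<open>0 \<le> A\<close> by (simp add: real_sqrt_mult)
    also have "\<dots> \<le> sqrt (K * C\<^sup>2 + 1) * (D * ((2 * \<bar>R\<bar>) powr s * \<Delta>x powr s) * \<epsilon>)"
    proof (intro mult_left_mono order_trans[OF A_le])
      show "D * \<Delta>x ^ (CARD('n) - 1) * \<epsilon> \<le> D * ((2 * \<bar>R\<bar>) powr s * \<Delta>x powr s) * \<epsilon>"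
        using pow \<open>0 \<le> D\<close> \<open>0 < \<epsilon>\<close> by (intro mult_right_mono mult_left_mono) auto
    qed (use K(1) in simp)
    also have "\<dots> = B * \<Delta>x powr s * \<epsilon>" by (simp add: B_def)
    also have "\<dots> \<le> (1 + B) * \<Delta>x powr s * \<epsilon>"
      using \<open>0 < \<epsilon>\<close> by (intro mult_right_mono) auto
    finally show ?thesis unfolding w_def .
  qed
  \<comment> \<open>The summand \<open>1\<close> makes the constant positive also when \<open>P = 0\<close>.\<close>
  show ?thesis
    using main \<open>0 \<le> B\<close> unfolding s_def by (intro exI[of _ "1 + B"]) auto
qed

end
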